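(* Assume Hypothesis (H) (see context). Then there exist constants $C_1,C_2>0$, depending only on $\mathfrak e$ and $\gamma$, such that for every $\mu>0$ $$ \mathcal N^+(\hat{\bf h}_\mu,\mathfrak e_{\max})\le 1+C_1\,\mu\sum_{x\in\mathbb Z^d}|x|^{2-d+\gamma}|\hat v(x)|, \qquad \mathcal N^-(\hat{\bf h}_\mu,\mathfrak e_{\min})\le 1+C_2\,\mu\sum_{x\in\mathbb Z^d}|x|^{2-d+\gamma}|\hat v(x)|. $$ In particular, for every $\mu>0$ the number of eigenvalues of $\hat{\bf h}_\mu$ outside $[\mathfrak e_{\min},\mathfrak e_{\max}]$ is finite.
   Context: Let $d\in\{1,2\}$ and $\mathbb T^d=(-\pi,\pi]^d$ with normalized Haar measure $dp$ ($\int_{\mathbb T^d}dp=1$). Let $\hat{\mathfrak e}\in\ell^1(\mathbb Z^d)$ with $\overline{\hat{\mathfrak e}(-x)}=\hat{\mathfrak e}(x)$, and $\hat v:\mathbb Z^d\to\mathbb R$. On $\ell^2(\mathbb Z^d)$ define $(\hat{\bf h}_0\hat f)(x)=\sum_{y\in\mathbb Z^d}\hat{\mathfrak e}(y)\hat f(x+y)$, $(\hat{\bf v}\hat f)(x)=\hat v(x)\hat f(x)$, and $\hat{\bf h}_\mu=\hat{\bf h}_0+\mu\hat{\bf v}$, $\mu\ge0$. Let $\mathcal F:\ell^2(\mathbb Z^d)\to L^2(\mathbb T^d)$, $(\mathcal F\hat f)(p)=\sum_x\hat f(x)e^{ix\cdot p}$, with inverse $(\mathcal F^*f)(x)=\int_{\mathbb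 T^d}f(p)e^{-ix\cdot p}dp$. Set $\mathfrak e:=\mathcal F\hat{\mathfrak e}$ (a continuous real function on $\mathbb T^d$), $\mathfrak e_{\min}=\min\mathfrak e$, $\mathfrak e_{\max}=\max\mathfrak e$. Hypothesis (H): (a) $\mathfrak e$ has a unique minimum point $p_0$ and a unique maximum point $p^0$, $\mathfrak e$ is $C^2$ in a neighbourhood of $p_0$ and of $p^0$, and both critical points are non-degenerate (invertible Hessian); (b) there exists $\gamma\in(0,1)$ with $0<\sum_{x\in\mathbb Z^d}|x|^{2-d+\gamma}|\hat v(x)|<\infty$. Under (H), $\hat v\in\ell^1$ and $\sigma_{ess}(\hat{\bf h}_\mu)=[\mathfrak e_{\min},\mathfrak e_{\max}]$. For a self-adjoint operator $A$ and $\lambda\in\mathbb R$, $\mathcal N^+(A,\lambda)$ (resp. $\mathcal N^-(A,\lambda)$) denotes the number of eigenvalues of $A$ in $(\lambda,\infty)$ (resp. $(-\infty,\lambda)$), counted with multiplicity. *)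

theory Defs
  imports "HOL-Analysis.Analysis" "HOL-Library.Extended_Real"
begin

text \<open>Lattice points of Z^d are modelled as int^'n with CARD('n) = d;
  quasi-momenta as real^'n.\<close>

definition lat_to_real :: "int^'n \<Rightarrow> real^'n" where
  "lat_to_real x = (\<chi> i. real_of_int (x $ i))"

definition lat_norm :: "int^'n \<Rightarrow> real" where
  "lat_norm x = norm (lat_to_real x)"

definition torus :: "(real^'n) set" where
  "torus = {p. \<forall>i. - pi < p $ i \<and> p $ i \<le> pi}"

text \<open>The dispersion relation e = F e_hat, e(p) = sum_x e_hat(x) exp(i x.p).
  It is real-valued under the symmetry hypothesis; we take its real part.\<close>
definition disp :: "(int^'n \<Rightarrow> complex) \<Rightarrow> real^'n \<Rightarrow> real" where
  "disp eh p = Re (\<Sum>\<^sub>\<infinity>x. eh x * cis (lat_to_real x \<bullet> p))"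

definition l2 :: "(int^'n \<Rightarrow> complex) \<Rightarrow> bool" where
  "l2 f \<longleftrightarrow> (\<lambda>x. (cmod (f x))\<^sup>2) summable_on UNIV"

definition hop :: "(int^'n \<Rightarrow> complex) \<Rightarrow> (int^'n \<Rightarrow> real) \<Rightarrow> real
                   \<Rightarrow> (int^'n \<Rightarrow> complex) \<Rightarrow> int^'n \<Rightarrow> complex" where
  "hop eh v \<mu> f x = (\<Sum>\<^sub>\<infinity>y. eh y * f (x + y)) + complex_of_real (\<mu> * v x) * f x"

definition is_eigvec :: "(int^'n \<Rightarrow> complex) \<Rightarrow> (int^'n \<Rightarrow> real) \<Rightarrow> real
                   \<Rightarrow> real \<Rightarrow> (int^'n \<Rightarrow> complex) \<Rightarrow> bool" where
  "is_eigvec eh v \<mu> E f \<longleftrightarrow> l2 f \<and> f \<noteq> (\<lambda>_. 0) \<and>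
      (\<forall>x. hop eh v \<mu> f x = complex_of_real E * f x)"

definition lin_indep :: "(int^'n \<Rightarrow> complex) set \<Rightarrow> bool" where
  "lin_indep S \<longleftrightarrow> (\<forall>c. (\<forall>x. (\<Sum>f\<in>S. c f * f x) = 0) \<longrightarrow> (\<forall>f\<in>S. c f = 0))"

text \<open>Number of eigenvalues (with multiplicity) in a set I: the dimension of the
  span of all eigenvectors with eigenvalue in I, i.e. the supremum of the sizes
  of finite linearly independent families of such eigenvectors.\<close>
definition eig_count :: "(int^'n \<Rightarrow> complex) \<Rightarrow> (int^'n \<Rightarrow> real) \<Rightarrow> real
                   \<Rightarrow> real set \<Rightarrow> enat" where
  "eig_count eh v \<mu> I = (SUP S\<in>{S. finite S \<and> lin_indep S \<and>
        (\<forall>f\<in>S. \<exists>E\<in>I. is_eigvec eh v \<mu> E f)}. enat (card S))"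

definition Nplus where "Nplus eh v \<mu> t = eig_count eh v \<mu> {t<..}"
definition Nminus where "Nminus eh v \<mu> t = eig_count eh v \<mu> {..<t}"

definition C2_nondeg_at :: "(real^'n \<Rightarrow> real) \<Rightarrow> real^'n \<Rightarrow> bool" where
  "C2_nondeg_at f p0 \<longleftrightarrow> (\<exists>U g H. open U \<and> p0 \<in> U \<and>
     (\<forall>p\<in>U. (f has_derivative (\<lambda>h. g p \<bullet> h)) (at p)) \<and>
     (\<forall>p\<in>U. (g has_derivative (\<lambda>h. H p *v h)) (at p)) \<and>
     continuous_on U H \<and> invertible (H p0))"

end

theory Submission
  imports Defs "HOL-Probability.Probability" "HOL-Library.Function_Algebras"
begin

text \<open>
  Let \<open>B f = emax * \<parallel>f\<parallel>\<^sup>2 - \<langle>h0 f, f\<rangle>\<close>; in Fourier space this is the integral of \<open>|Ff|\<^sup>2\<close> against the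
  weight \<open>emax - e\<close>, which is at least \<open>c * |p - p1|\<^sup>2\<close>. If \<open>f 0 = 0\<close> then, up to a phase, \<open>f x\<close> is the
  integral of \<open>Ff\<close> against \<open>exp (i x \<bullet> (p - p1)) - 1\<close>. Put \<open>s = 2 - d + \<gamma>\<close>. Since
  \<open>|exp (i t) - 1|\<^sup>2 \<le> 4 * |t| powr s\<close> and \<open>|q| powr (s - 2) = |q| powr (\<gamma> - d)\<close> is integrable at the
  origin, the Cauchy-Schwarz inequality gives \<open>|f x|\<^sup>2 \<le> C * |x| powr s * B f\<close>.

  On the span of the eigenvectors with eigenvalue above \<open>emax\<close> one has \<open>B f \<le> \<mu> * \<Sum> |v| |f|\<^sup>2\<close>.
  Requiring \<open>f 0 = 0\<close> costs one dimension, and a trace over a \<open>B\<close>-orthonormal basis of what remains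
  bounds its dimension by \<open>C * \<mu> * \<Sum> |x| powr s * |v x|\<close>. The lower edge follows by changing the signs
  of \<open>e\<close> and \<open>v\<close>.
\<close>

section \<open>Non-degenerate maxima\<close>

lemma lipschitz_gradient_increment:
  fixes f :: "'a::real_inner \<Rightarrow> real"
  assumes "convex S" and grad: "\<And>x. x \<in> S \<Longrightarrow> (f has_derivative (\<lambda>h. g x \<bullet> h)) (at x)"
    and lip: "L-lipschitz_on S g" and x: "x \<in> S" "x + h \<in> S"
  shows "g x \<bullet> h - L * (norm h)\<^sup>2 \<le> f (x + h) - f x"
proof -
  define y where "y s = x + s *\<^sub>R h" for s
  have y_mem: "y s \<in> S" if "s \<in> {0..1}" for s
    using convexD_alt[OF \<open>convex S\<close> x, of s] that by (simp add: y_def algebra_simps)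
  have "((\<lambda>s. f (y s)) has_derivative (\<lambda>u. g (y s) \<bullet> (u *\<^sub>R h))) (at s within {0..1})"
    if "0 \<le> s" "s \<le> 1" for s
  proof -
    have "(y has_derivative (\<lambda>u. u *\<^sub>R h)) (at s within {0..1})"
      unfolding y_def by (auto intro!: derivative_eq_intros)
    moreover have "(f has_derivative (\<lambda>h. g (y s) \<bullet> h)) (at (y s))"
      using that by (intro grad y_mem) simp
    ultimately show ?thesis
      by (rule has_derivative_compose)
  qed
  from mvt_simple[OF zero_less_one this] obtain s where s: "s \<in> {0<..<1}" "f (y 1) - f (y 0) = g (y s) \<bullet> h"
    by auto
  have "norm (g (y s) - g x) \<le> L * norm (y s - x)"
    using lipschitz_onD[OF lip y_mem[of s] x(1)] s(1) by (simp add: dist_norm)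
  also have "\<dots> \<le> L * norm h"
    using s(1) lipschitz_on_nonneg[OF lip] by (intro mult_left_mono) (auto simp: y_def mult_left_le_one_le)
  finally have "norm (g (y s) - g x) * norm h \<le> L * norm h * norm h"
    by (rule mult_right_mono) simp
  then have "\<bar>(g (y s) - g x) \<bullet> h\<bar> \<le> L * (norm h)\<^sup>2"
    using order_trans[OF Cauchy_Schwarz_ineq2] by (simp add: power2_eq_square mult.assoc)
  with s(2) show ?thesis
    by (simp add: y_def inner_diff_left)
qed

text \<open>One gradient ascent step from \<open>x\<close>, with step size \<open>1 / (2 * L)\<close>, cannot overshoot the maximum \<open>f p\<close>.\<close>

lemma gradient_ascent_gain:
  fixes f :: "'a::real_inner \<Rightarrow> real"
  assumes grad: "\<And>x. x \<in> cball p R \<Longrightarrow> (f has_derivative (\<lambda>h. g x \<bullet> h)) (at x)"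
    and lip: "L-lipschitz_on (cball p R) g" and "0 < L"
    and max: "\<And>x. f x \<le> f p" and "g p = 0" and x: "x \<in> cball p (R / 2)"
  shows "(norm (g x))\<^sup>2 \<le> 4 * L * (f p - f x)"
proof -
  define h where "h = (1 / (2 * L)) *\<^sub>R g x"
  have dist_x: "norm (x - p) \<le> R / 2"
    using x by (simp add: dist_norm norm_minus_commute)
  then have R: "norm (x - p) \<le> R" "0 \<le> R"
    using norm_ge_zero[of "x - p"] by linarith+
  then have ball: "x \<in> cball p R" "p \<in> cball p R"
    by (simp_all add: dist_norm norm_minus_commute)
  then have "norm (g x) \<le> L * norm (x - p)"
    using lipschitz_onD[OF lip, of x p] \<open>g p = 0\<close> by (simp add: dist_norm)
  then have "norm h \<le> norm (x - p) / 2"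
    using \<open>0 < L\<close> by (simp add: h_def field_simps)
  then have "norm (x + h - p) \<le> R"
    using norm_triangle_ineq[of "x - p" h] dist_x R by (simp add: algebra_simps)
  then have "x + h \<in> cball p R"
    by (simp add: dist_norm norm_minus_commute)
  then have "g x \<bullet> h - L * (norm h)\<^sup>2 \<le> f (x + h) - f x"
    using lipschitz_gradient_increment[OF convex_cball grad lip] ball by blast
  also have "\<dots> \<le> f p - f x"
    using max by simp
  finally show ?thesis
    using \<open>0 < L\<close> by (simp add: h_def dot_square_norm power_mult_distrib field_simps power2_eq_square)
qed

lemma has_derivative_inj_lower_bound:
  fixes g :: "'a::real_normed_vector \<Rightarrow> 'b::euclidean_space"
  assumes g': "(g has_derivative A) (at p)" and "inj A"
  obtains b r where "b > 0" "r > 0" "\<And>x. norm (x - p) < r \<Longrightarrow> b * norm (x - p) \<le> norm (g x - g p)"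
proof -
  have "linear A"
    using g' by (rule has_derivative_linear)
  then obtain b where b: "b > 0" "\<And>h. b * norm h \<le> norm (A h)"
    using \<open>inj A\<close> linear_inj_bounded_below_pos by blast
  then obtain r where r: "r > 0"
    "\<And>x. norm (x - p) < r \<Longrightarrow> norm (g x - g p - A (x - p)) \<le> b / 2 * norm (x - p)"
    using g' unfolding has_derivative_at_alt by (metis half_gt_zero)
  have "b / 2 * norm (x - p) \<le> norm (g x - g p)" if "norm (x - p) < r" for x
    using b(2)[of "x - p"] r(2)[OF that] norm_triangle_ineq4[of "g x - g p" "g x - g p - A (x - p)"]
    by simp
  with b r show thesis
    by (intro that[of "b / 2" r]) auto
qed

lemma continuous_derivative_locally_lipschitz:
  fixes g :: "real^'n \<Rightarrow> real^'m"
  assumes "open U" "p \<in> U" and g': "\<And>x. x \<in> U \<Longrightarrow> (g has_derivative ((*v) (H x))) (at x)"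
    and H: "continuous_on U H"
  obtains L R where "L > 0" "R > 0" "cball p R \<subseteq> U" "L-lipschitz_on (cball p R) g"
proof -
  obtain R where R: "R > 0" "cball p R \<subseteq> U"
    using assms(1,2) open_contains_cball by blast
  have "compact (H ` cball p R)"
    by (intro compact_continuous_image continuous_on_subset[OF H] R compact_cball)
  then obtain K where K: "K > 0" "\<And>x. x \<in> cball p R \<Longrightarrow> norm (H x) \<le> K"
    using compact_imp_bounded bounded_pos by (metis imageI)
  define L where "L = real CARD('m) * real CARD('n) * K"
  have "L > 0"
    using K by (simp add: L_def)
  have "onorm ((*v) (H x)) \<le> L" if "x \<in> cball p R" for x
    unfolding L_def
  proof (rule onorm_le_matrix_component)
    show "\<bar>H x $ i $ j\<bar> \<le> K" for i j
      by (metis K(2) Finite_Cartesian_Product.norm_nth_le order_trans real_norm_def that)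
  qed
  then have "L-lipschitz_on (cball p R) g"
    using R \<open>L > 0\<close>
    by (intro bounded_derivative_imp_lipschitz[where f' = "\<lambda>x. (*v) (H x)"])
       (auto intro!: has_derivative_at_withinI[OF g'])
  with \<open>L > 0\<close> R show thesis
    using that by blast
qed

lemma nondegenerate_max_quadratic_bound:
  fixes f :: "real^'n \<Rightarrow> real"
  assumes C2: "C2_nondeg_at f p" and max: "\<And>x. f x \<le> f p"
  obtains c r where "c > 0" "r > 0" "\<And>x. x \<in> ball p r \<Longrightarrow> c * (norm (x - p))\<^sup>2 \<le> f p - f x"
proof -
  obtain U g H where U: "open U" "p \<in> U"
    and f': "\<And>x. x \<in> U \<Longrightarrow> (f has_derivative (\<lambda>h. g x \<bullet> h)) (at x)"
    and g': "\<And>x. x \<in> U \<Longrightarrow> (g has_derivative ((*v) (H x))) (at x)"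
    and H: "continuous_on U H" "invertible (H p)"
    using C2 unfolding C2_nondeg_at_def by blast
  obtain L R where LR: "L > 0" "R > 0" "cball p R \<subseteq> U" and lip: "L-lipschitz_on (cball p R) g"
    using continuous_derivative_locally_lipschitz[OF U g' H(1)] by blast
  have "(\<lambda>h. g p \<bullet> h) = (\<lambda>_. 0)"
    using differential_zero_maxmin[OF U(2,1) f'[OF U(2)]] max by blast
  then have "g p = 0"
    by (metis inner_eq_zero_iff)
  obtain b d where b: "b > 0" "d > 0" "\<And>x. norm (x - p) < d \<Longrightarrow> b * norm (x - p) \<le> norm (g x)"
    using has_derivative_inj_lower_bound[OF g'[OF U(2)] inj_matrix_vector_mult[OF H(2)]] \<open>g p = 0\<close>
    by (metis diff_zero)
  show thesis
  proof (rule that[of "b\<^sup>2 / (4 * L)" "min d (R / 2)"])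
    fix x assume "x \<in> ball p (min d (R / 2))"
    then have x: "norm (x - p) < d" "x \<in> cball p (R / 2)"
      by (auto simp: dist_norm norm_minus_commute)
    have "(b * norm (x - p))\<^sup>2 \<le> (norm (g x))\<^sup>2"
      using b(1) b(3)[OF x(1)] by (intro power_mono) auto
    also have "\<dots> \<le> 4 * L * (f p - f x)"
      using gradient_ascent_gain[of p R f g L x] f' LR lip max \<open>g p = 0\<close> x(2) by blast
    finally show "b\<^sup>2 / (4 * L) * (norm (x - p))\<^sup>2 \<le> f p - f x"
      using \<open>L > 0\<close> by (simp add: power_mult_distrib field_simps)
  qed (use b LR in auto)
qed

lemma C2_nondeg_at_uminus:
  assumes "C2_nondeg_at f p"
  shows "C2_nondeg_at (\<lambda>x. - f x) p"
proof -
  obtain U g H where U: "open U" "p \<in> U"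
    and f': "\<And>x. x \<in> U \<Longrightarrow> (f has_derivative (\<lambda>h. g x \<bullet> h)) (at x)"
    and g': "\<And>x. x \<in> U \<Longrightarrow> (g has_derivative (\<lambda>h. H x *v h)) (at x)"
    and H: "continuous_on U H" "invertible (H p)"
    using assms unfolding C2_nondeg_at_def by blast
  have neg: "(- A) *v h = - (A *v h)" for A :: "real^'a^'a" and h
    by (simp add: matrix_vector_mult_def vec_eq_iff sum_negf)
  have "invertible (- H p)"
    using H(2) by (auto simp: invertible_left_inverse matrix_left_invertible_injective inj_on_def neg)
  moreover have "((\<lambda>x. - f x) has_derivative (\<lambda>h. (- g x) \<bullet> h)) (at x)" if "x \<in> U" for x
    using has_derivative_minus[OF f'[OF that]] by simp
  moreover have "((\<lambda>x. - g x) has_derivative (\<lambda>h. (- H x) *v h)) (at x)" if "x \<in> U" for x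
    using has_derivative_minus[OF g'[OF that]] by (simp add: neg)
  moreover have "continuous_on U (\<lambda>x. - H x)"
    by (intro continuous_intros H)
  ultimately show ?thesis
    unfolding C2_nondeg_at_def using U
    by (intro exI[of _ U] exI[of _ "\<lambda>x. - g x"] exI[of _ "\<lambda>x. - H x"]) blast
qed

lemma positive_lower_bound_on_compact:
  fixes f :: "'a::topological_space \<Rightarrow> real"
  assumes "compact S" "continuous_on S f" "\<And>x. x \<in> S \<Longrightarrow> 0 < f x"
  obtains m where "0 < m" "\<And>x. x \<in> S \<Longrightarrow> m \<le> f x"
proof (cases "S = {}")
  case True
  then show thesis
    by (intro that[of 1]) auto
next
  case False
  with assms obtain x0 where "x0 \<in> S" "\<And>x. x \<in> S \<Longrightarrow> f x0 \<le> f x"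
    using continuous_attains_inf by metis
  with assms(3) show thesis
    by (intro that[of "f x0"]) auto
qed

lemma quadratic_lower_bound_on_compact:
  fixes f :: "'a::real_normed_vector \<Rightarrow> real"
  assumes "compact S" and cont: "continuous_on S f"
    and pos: "\<And>x. x \<in> S \<Longrightarrow> x \<noteq> 0 \<Longrightarrow> 0 < f x"
    and c: "0 < c" "0 < r" "\<And>x. x \<in> ball 0 r \<Longrightarrow> c * (norm x)\<^sup>2 \<le> f x"
  obtains m where "0 < m" "\<And>x. x \<in> S \<Longrightarrow> m * (norm x)\<^sup>2 \<le> f x"
proof -
  have "compact (S - ball 0 r)"
    using \<open>compact S\<close> by (intro compact_diff) auto
  moreover have "continuous_on (S - ball 0 r) (\<lambda>x. f x / (norm x)\<^sup>2)"
    using c(2) by (intro continuous_intros continuous_on_subset[OF cont]) auto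
  moreover have "0 < f x / (norm x)\<^sup>2" if "x \<in> S - ball 0 r" for x
  proof -
    have "x \<noteq> 0"
      using that c(2) by auto
    with pos[of x] that show ?thesis
      by simp
  qed
  ultimately obtain m where m: "0 < m" "\<And>x. x \<in> S - ball 0 r \<Longrightarrow> m \<le> f x / (norm x)\<^sup>2"
    using positive_lower_bound_on_compact[of "S - ball 0 r" "\<lambda>x. f x / (norm x)\<^sup>2"] by blast
  show thesis
  proof (rule that[of "min c m"])
    show "min c m * (norm x)\<^sup>2 \<le> f x" if "x \<in> S" for x
    proof (cases "x \<in> ball 0 r")
      case True
      have "min c m * (norm x)\<^sup>2 \<le> c * (norm x)\<^sup>2"
        by (intro mult_right_mono) auto
      with c(3)[OF True] show ?thesis
        by linarith
    next
      case False
      then have "min c m * (norm x)\<^sup>2 \<le> f x / (norm x)\<^sup>2 * (norm x)\<^sup>2"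
        using m(2)[of x] that by (intro mult_right_mono) auto
      also have "\<dots> = f x"
        using False c(2) by auto
      finally show ?thesis .
    qed
  qed (use c m in simp)
qed

section \<open>Hermitian forms\<close>

lemma (in vector_space) independent_subset_kernel:
  assumes "finite S" "independent S" "S \<noteq> {}"
    and add: "\<And>u w. \<phi> (u + w) = \<phi> u + \<phi> w" and scale: "\<And>a u. \<phi> (scale a u) = a * \<phi> u"
  obtains T where "finite T" "independent T" "T \<subseteq> {u \<in> span S. \<phi> u = 0}" "card S \<le> Suc (card T)"
proof -
  obtain T where T: "T \<subseteq> {u \<in> span S. \<phi> u = 0}" "independent T" "{u \<in> span S. \<phi> u = 0} \<subseteq> span T"
    by (rule maximal_independent_subset)
  obtain k where "k \<in> S" and k: "\<phi> k = 0 \<Longrightarrow> \<forall>u\<in>S. \<phi> u = 0"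
    using \<open>S \<noteq> {}\<close> by (cases "\<forall>u\<in>S. \<phi> u = 0") auto
  have "S \<subseteq> span (insert k T)"
  proof
    fix u assume "u \<in> S"
    define w where "w = u + scale (- \<phi> u / \<phi> k) k"
    have "\<phi> w = \<phi> u + - \<phi> u / \<phi> k * \<phi> k"
      unfolding w_def add scale ..
    then have "\<phi> w = 0"
      using k \<open>u \<in> S\<close> by (cases "\<phi> k = 0") auto
    moreover have "w \<in> span S"
      unfolding w_def using \<open>u \<in> S\<close> \<open>k \<in> S\<close> by (intro span_add span_scale span_base)
    ultimately have "w \<in> span (insert k T)"
      using T(3) span_mono[of T "insert k T"] by blast
    then have "w + scale (\<phi> u / \<phi> k) k \<in> span (insert k T)"
      by (intro span_add span_scale) (auto intro: span_base)
    then show "u \<in> span (insert k T)"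
      by (simp add: w_def)
  qed
  moreover have "finite T"
    using independent_span_bound[OF assms(1) T(2)] T(1) by blast
  ultimately have "card S \<le> card (insert k T)"
    using independent_span_bound[of "insert k T" S] assms(2) by blast
  also have "\<dots> \<le> Suc (card T)"
    by (rule card_insert_le_m1) simp_all
  finally show thesis
    using that T \<open>finite T\<close> by blast
qed

locale hermitian_form_on = vector_space scale
  for scale :: "complex \<Rightarrow> 'b \<Rightarrow> 'b::ab_group_add" +
  fixes V :: "'b set" and B :: "'b \<Rightarrow> 'b \<Rightarrow> complex"
  assumes subspace_carrier: "subspace V"
    and add_left: "u \<in> V \<Longrightarrow> u' \<in> V \<Longrightarrow> w \<in> V \<Longrightarrow> B (u + u') w = B u w + B u' w"
    and scale_left: "u \<in> V \<Longrightarrow> w \<in> V \<Longrightarrow> B (scale a u) w = a * B u w"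
    and commute: "u \<in> V \<Longrightarrow> w \<in> V \<Longrightarrow> B w u = cnj (B u w)"
begin

lemma sum_left:
  assumes "\<And>i. i \<in> I \<Longrightarrow> f i \<in> V" "w \<in> V"
  shows "B (\<Sum>i\<in>I. scale (a i) (f i)) w = (\<Sum>i\<in>I. a i * B (f i) w)"
proof -
  have zero: "B 0 w = 0"
    using scale_left[of 0 w 0] subspace_0[OF subspace_carrier] assms(2) by simp
  show ?thesis
    using assms(1)
  proof (induction I rule: infinite_finite_induct)
    case (insert i I)
    then have "(\<Sum>i\<in>I. scale (a i) (f i)) \<in> V" "scale (a i) (f i) \<in> V"
      by (auto intro!: subspace_sum subspace_scale subspace_carrier)
    with insert assms(2) show ?case
      by (simp add: add_left scale_left)
  qed (simp_all add: zero)
qed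

lemma self_real: "u \<in> V \<Longrightarrow> B u u = of_real (Re (B u u))"
  using commute[of u u] by (simp add: complex_eq_iff)

definition orthonormal :: "'b set \<Rightarrow> bool" where
  "orthonormal E \<longleftrightarrow> (\<forall>u\<in>E. \<forall>w\<in>E. B u w = of_bool (u = w))"

lemma orthogonal_residual:
  assumes "finite E" "E \<subseteq> V" "orthonormal E" "a \<in> V"
  obtains q where "q \<in> span E" "a - q \<in> V" "\<And>e. e \<in> E \<Longrightarrow> B (a - q) e = 0"
proof
  define q where "q = (\<Sum>e\<in>E. scale (B a e) e)"
  show "q \<in> span E"
    unfolding q_def by (intro span_sum span_scale span_base)
  moreover have "span E \<subseteq> V"
    using assms(2) subspace_carrier by (rule span_minimal)
  ultimately have "q \<in> V"
    by blast
  then show "a - q \<in> V"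
    using assms(4) by (intro subspace_diff subspace_carrier)
  fix e assume "e \<in> E"
  have "B q e = (\<Sum>e'\<in>E. B a e' * B e' e)"
    unfolding q_def using assms(2) \<open>e \<in> E\<close> by (intro sum_left) auto
  also have "\<dots> = (\<Sum>e'\<in>E. if e' = e then B a e' else 0)"
    using assms(3) \<open>e \<in> E\<close> by (intro sum.cong) (auto simp: orthonormal_def)
  also have "\<dots> = B a e"
    using assms(1) \<open>e \<in> E\<close> by simp
  finally show "B (a - q) e = 0"
    using add_left[of "a - q" q e] \<open>a - q \<in> V\<close> \<open>q \<in> V\<close> \<open>e \<in> E\<close> assms(2) by auto
qed

lemma orthonormal_insert:
  assumes "E \<subseteq> V" "orthonormal E" "r \<in> V" "0 < Re (B r r)" and orth: "\<And>e. e \<in> E \<Longrightarrow> B r e = 0"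
  obtains e where "e \<in> V" "orthonormal (insert e E)" "r \<in> span {e}"
proof -
  define t where "t = sqrt (Re (B r r))"
  have t: "t > 0" "B r r = of_real (t * t)"
    using assms(4) self_real[OF assms(3)] by (simp_all add: t_def)
  define e where "e = scale (of_real (1 / t)) r"
  have "e \<in> V"
    using assms(3) by (simp add: e_def subspace_carrier subspace_scale)
  have "B e e = of_real (1 / t) * cnj (of_real (1 / t) * B r r)"
    using assms(3) \<open>e \<in> V\<close> commute[of r e] scale_left[of r] by (simp add: e_def)
  then have unit: "B e e = 1"
    using t by simp
  have cross: "B e e' = 0 \<and> B e' e = 0" if "e' \<in> E" for e'
  proof -
    have "e' \<in> V" "B e e' = 0"
      using assms(1,3) that orth by (auto simp: e_def scale_left)
    with commute[of e e'] \<open>e \<in> V\<close> show ?thesis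
      by simp
  qed
  have "orthonormal (insert e E)"
    unfolding orthonormal_def
  proof (intro ballI)
    fix u w assume "u \<in> insert e E" "w \<in> insert e E"
    then show "B u w = of_bool (u = w)"
      using assms(2) unit cross by (auto simp: orthonormal_def)
  qed
  moreover have "r = scale (of_real t) e"
    using t by (simp add: e_def)
  then have "r \<in> span {e}"
    by (metis insertI1 span_base span_scale)
  ultimately show thesis
    using that \<open>e \<in> V\<close> by blast
qed

lemma gram_schmidt:
  assumes "finite S" "S \<subseteq> V" and pos: "\<And>u. u \<in> V \<Longrightarrow> u \<noteq> 0 \<Longrightarrow> 0 < Re (B u u)"
  obtains E where "finite E" "E \<subseteq> V" "orthonormal E" "S \<subseteq> span E"
  using assms(1,2)
proof (induction S arbitrary: thesis rule: finite_induct)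
  case empty
  show ?case
    by (rule empty.prems(1)[of "{}"]) (auto simp: orthonormal_def)
next
  case (insert a S)
  then obtain E where E: "finite E" "E \<subseteq> V" "orthonormal E" "S \<subseteq> span E"
    by blast
  obtain q where q: "q \<in> span E" "a - q \<in> V" "\<And>e. e \<in> E \<Longrightarrow> B (a - q) e = 0"
    using orthogonal_residual[OF E(1-3)] insert.prems(2) by blast
  show ?case
  proof (cases "a - q = 0")
    case True
    with q(1) E show ?thesis
      by (intro insert.prems(1)[of E]) auto
  next
    case False
    then obtain e where e: "e \<in> V" "orthonormal (insert e E)" "a - q \<in> span {e}"
      using orthonormal_insert[OF E(2,3) q(2) pos[OF q(2)] q(3)] by blast
    have mono: "span {e} \<subseteq> span (insert e E)" "span E \<subseteq> span (insert e E)"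
      by (intro span_mono; blast)+
    then have "(a - q) + q \<in> span (insert e E)"
      using q(1) e(3) by (intro span_add) blast+
    with E e mono show ?thesis
      by (intro insert.prems(1)[of "insert e E"]) auto
  qed
qed

end

lemma hermitian_form_on_diff:
  assumes "hermitian_form_on s V B" "hermitian_form_on s V B'"
  shows "hermitian_form_on s V (\<lambda>u w. B u w - B' u w)"
proof -
  interpret hermitian_form_on s V B by fact
  interpret B': hermitian_form_on s V B' by fact
  show ?thesis
  proof
    show "B w u - B' w u = cnj (B u w - B' u w)" if "u \<in> V" "w \<in> V" for u w
      using commute[OF that] B'.commute[OF that] by simp
  qed (simp_all add: subspace_carrier add_left B'.add_left scale_left B'.scale_left right_diff_distrib)
qed

lemma hermitian_form_on_mono:
  assumes "hermitian_form_on s V B" "module.subspace s W" "W \<subseteq> V"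
  shows "hermitian_form_on s W B"
proof -
  interpret hermitian_form_on s V B by fact
  show ?thesis
    by unfold_locales (use assms(2,3) in \<open>auto intro: add_left scale_left commute\<close>)
qed

locale hermitian_pencil =
  hermitian_form_on scale V B + inner: hermitian_form_on scale V ip
  for scale :: "complex \<Rightarrow> 'b \<Rightarrow> 'b::ab_group_add" and V B ip +
  assumes inner_nonneg: "u \<in> V \<Longrightarrow> 0 \<le> Re (ip u u)"
begin

definition eigenvector :: "real \<Rightarrow> 'b \<Rightarrow> bool" where
  "eigenvector E u \<longleftrightarrow> u \<in> V \<and> (\<forall>w\<in>V. B u w = of_real E * ip u w)"

lemma eigenvectors_orthogonal:
  assumes "eigenvector E u" "eigenvector E' w" "E \<noteq> E'"
  shows "ip u w = 0"
proof -
  have "of_real E * ip u w = of_real E' * ip u w"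
    using assms(1,2) commute[of u w] inner.commute[of u w] by (auto simp: eigenvector_def)
  with \<open>E \<noteq> E'\<close> show ?thesis
    by simp
qed

lemma eigenvector_sum:
  assumes "\<And>i. i \<in> I \<Longrightarrow> eigenvector E (f i)"
  shows "eigenvector E (\<Sum>i\<in>I. scale (a i) (f i))"
  using assms
  by (auto simp: eigenvector_def sum_left inner.sum_left sum_distrib_left mult.left_commute
      intro!: subspace_sum subspace_scale subspace_carrier)

lemma span_eigenvectors_decomposition:
  assumes "finite S" and ev: "\<And>u. u \<in> S \<Longrightarrow> eigenvector (\<epsilon> u) u" and "w \<in> span S"
  obtains F where "\<And>E. eigenvector E (F E)" "w = (\<Sum>E\<in>\<epsilon> ` S. scale 1 (F E))"
proof -
  obtain a where "w = (\<Sum>u\<in>S. scale (a u) u)"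
    using \<open>w \<in> span S\<close> span_finite[OF \<open>finite S\<close>] by auto
  then have "w = (\<Sum>E\<in>\<epsilon> ` S. scale 1 (\<Sum>u\<in>{u\<in>S. \<epsilon> u = E}. scale (a u) u))"
    using sum.group[of S "\<epsilon> ` S" \<epsilon> "\<lambda>u. scale (a u) u"] \<open>finite S\<close> by simp
  moreover have "eigenvector E (\<Sum>u\<in>{u\<in>S. \<epsilon> u = E}. scale (a u) u)" for E
    using ev by (intro eigenvector_sum) auto
  ultimately show thesis
    by (rule that[rotated])
qed

lemma nonneg_on_span_eigenvectors:
  assumes "finite S" and ev: "\<And>u. u \<in> S \<Longrightarrow> 0 \<le> \<epsilon> u \<and> eigenvector (\<epsilon> u) u" and "w \<in> span S"
  shows "0 \<le> Re (B w w)"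
proof -
  obtain F where F: "\<And>E. eigenvector E (F E)" and w_F: "w = (\<Sum>E\<in>\<epsilon> ` S. scale 1 (F E))"
    using span_eigenvectors_decomposition[of S \<epsilon> w] assms by blast
  then have F_mem: "F E \<in> V" for E
    by (simp add: eigenvector_def)
  then have "w \<in> V"
    unfolding w_F by (intro subspace_sum subspace_scale subspace_carrier)
  have ip_F: "ip (F E) w = ip (F E) (F E)" if "E \<in> \<epsilon> ` S" for E
  proof -
    have "ip w (F E) = (\<Sum>E'\<in>\<epsilon> ` S. 1 * ip (F E') (F E))"
      unfolding w_F using F_mem by (intro inner.sum_left)
    also have "\<dots> = (\<Sum>E'\<in>\<epsilon> ` S. if E' = E then ip (F E) (F E) else 0)"
      using eigenvectors_orthogonal[OF F F] by (intro sum.cong) auto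
    also have "\<dots> = ip (F E) (F E)"
      using that \<open>finite S\<close> by simp
    finally show ?thesis
      using inner.commute \<open>w \<in> V\<close> F_mem by metis
  qed
  have "B w w = (\<Sum>E\<in>\<epsilon> ` S. 1 * B (F E) w)"
    using sum_left[of "\<epsilon> ` S" F w "\<lambda>_. 1"] F_mem \<open>w \<in> V\<close> w_F by simp
  also have "\<dots> = (\<Sum>E\<in>\<epsilon> ` S. of_real E * ip (F E) (F E))"
    using F \<open>w \<in> V\<close> ip_F by (auto simp: eigenvector_def intro!: sum.cong)
  also have "Re \<dots> = (\<Sum>E\<in>\<epsilon> ` S. E * Re (ip (F E) (F E)))"
    by simp
  also have "0 \<le> \<dots>"
    using ev F_mem inner_nonneg by (intro sum_nonneg mult_nonneg_nonneg) auto
  finally show ?thesis .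
qed

end

section \<open>A trace estimate\<close>

definition scale_fun :: "'a::times \<Rightarrow> ('x \<Rightarrow> 'a) \<Rightarrow> 'x \<Rightarrow> 'a" where
  "scale_fun a f = (\<lambda>x. a * f x)"

lemma scale_fun_apply [simp]: "scale_fun a f x = a * f x"
  by (simp add: scale_fun_def)

interpretation fun_space: vector_space "scale_fun :: 'a::field \<Rightarrow> ('x \<Rightarrow> 'a) \<Rightarrow> 'x \<Rightarrow> 'a"
  by unfold_locales (simp_all add: fun_eq_iff algebra_simps)

lemma sum_fun_apply: "(\<Sum>i\<in>I. f i) x = (\<Sum>i\<in>I. f i x)" for f :: "'i \<Rightarrow> 'x \<Rightarrow> 'a::comm_monoid_add"
  by (induction I rule: infinite_finite_induct) simp_all

lemma lin_indep_iff_independent: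
  assumes "finite S"
  shows "lin_indep S \<longleftrightarrow> fun_space.independent S"
  unfolding lin_indep_def fun_space.dependent_finite[OF assms]
  by (simp add: fun_eq_iff sum_fun_apply) blast

lemma has_sum_sum:
  fixes f :: "'i \<Rightarrow> 'x \<Rightarrow> 'a::topological_comm_monoid_add"
  assumes "finite I" "\<And>i. i \<in> I \<Longrightarrow> (f i has_sum s i) A"
  shows "((\<lambda>x. \<Sum>i\<in>I. f i x) has_sum (\<Sum>i\<in>I. s i)) A"
  using assms by (induction I rule: finite_induct) (auto intro: has_sum_add)

locale hermitian_form_on_functions =
  hermitian_form_on "scale_fun :: complex \<Rightarrow> ('x \<Rightarrow> complex) \<Rightarrow> 'x \<Rightarrow> complex" V B
  for V :: "('x \<Rightarrow> complex) set" and B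
begin

text \<open>Evaluating \<open>u = (\<Sum>e\<in>E. cnj (e x) * e)\<close> at \<open>x\<close> gives \<open>u x = B u u = (\<Sum>e\<in>E. |e x|\<^sup>2)\<close>.\<close>

lemma orthonormal_diagonal_bound:
  assumes "finite E" "E \<subseteq> V" "orthonormal E"
    and "0 \<le> K" and point: "\<And>u. u \<in> V \<Longrightarrow> (cmod (u x))\<^sup>2 \<le> K * Re (B u u)"
  shows "(\<Sum>e\<in>E. (cmod (e x))\<^sup>2) \<le> K"
proof -
  define T where "T = (\<Sum>e\<in>E. (cmod (e x))\<^sup>2)"
  define u where "u = (\<Sum>e\<in>E. scale_fun (cnj (e x)) e)"
  have u: "u \<in> V"
    unfolding u_def using assms(2)
    by (intro fun_space.subspace_sum fun_space.subspace_scale subspace_carrier) auto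
  have ux: "u x = of_real T"
    by (simp add: u_def T_def sum_fun_apply complex_norm_square mult.commute del: of_real_power)
  have u_left: "B u w = (\<Sum>e\<in>E. cnj (e x) * B e w)" if "w \<in> V" for w
    unfolding u_def using assms(2) that by (intro sum_left) auto
  have "B e u = e x" if "e \<in> E" for e
  proof -
    have "B u e = (\<Sum>e'\<in>E. cnj (e' x) * B e' e)"
      using u_left assms(2) that by blast
    also have "\<dots> = (\<Sum>e'\<in>E. if e' = e then cnj (e x) else 0)"
      using assms(3) that by (intro sum.cong) (auto simp: orthonormal_def)
    finally have "B u e = cnj (e x)"
      using assms(1) that by simp
    then show ?thesis
      using commute[OF u, of e] assms(2) that by auto
  qed
  then have "B u u = of_real T"
    by (simp add: u_left[OF u] T_def complex_norm_square mult.commute del: of_real_power)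
  then have "T\<^sup>2 \<le> K * T"
    using point[OF u] ux by simp
  moreover have "0 \<le> T"
    by (simp add: T_def sum_nonneg)
  ultimately show ?thesis
    unfolding T_def[symmetric] using \<open>0 \<le> K\<close> by (cases "T = 0") (auto simp: power2_eq_square)
qed

lemma positive_definite_if_point_bound:
  assumes K: "\<And>x. 0 \<le> K x" "\<And>u x. u \<in> V \<Longrightarrow> (cmod (u x))\<^sup>2 \<le> K x * Re (B u u)" and "u \<in> V" "u \<noteq> 0"
  shows "0 < Re (B u u)"
proof -
  obtain x where "u x \<noteq> 0"
    using \<open>u \<noteq> 0\<close> by (auto simp: fun_eq_iff)
  then have "0 < (cmod (u x))\<^sup>2"
    by simp
  also have "\<dots> \<le> K x * Re (B u u)"
    using K(2) \<open>u \<in> V\<close> .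
  finally show ?thesis
    using K(1)[of x] by (simp add: zero_less_mult_iff)
qed

theorem card_independent_le_trace:
  assumes S: "finite S" "fun_space.independent S" "S \<subseteq> V"
    and K: "\<And>x. 0 \<le> K x" "\<And>u x. u \<in> V \<Longrightarrow> (cmod (u x))\<^sup>2 \<le> K x * Re (B u u)"
    and w: "\<And>x. 0 \<le> w x" "\<And>u. u \<in> V \<Longrightarrow> Re (B u u) \<le> (\<Sum>\<^sub>\<infinity>x. w x * (cmod (u x))\<^sup>2)"
    and summable: "(\<lambda>x. w x * K x) summable_on UNIV"
  shows "real (card S) \<le> (\<Sum>\<^sub>\<infinity>x. w x * K x)"
proof -
  obtain E where E: "finite E" "E \<subseteq> V" "orthonormal E" "S \<subseteq> fun_space.span E"
    using gram_schmidt[OF S(1,3)] positive_definite_if_point_bound[OF K] by blast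
  have diagonal: "(\<Sum>e\<in>E. (cmod (e x))\<^sup>2) \<le> K x" for x
    using K by (intro orthonormal_diagonal_bound[OF E(1-3)])
  have "(\<lambda>x. w x * (cmod (e x))\<^sup>2) summable_on UNIV" if "e \<in> E" for e
  proof (rule summable_on_comparison_test[OF summable])
    have "(cmod (e x))\<^sup>2 \<le> (\<Sum>e\<in>E. (cmod (e x))\<^sup>2)" for x
      using that E(1) by (intro member_le_sum) auto
    then show "w x * (cmod (e x))\<^sup>2 \<le> w x * K x" for x
      using diagonal w(1) by (intro mult_left_mono) (auto intro: order_trans)
  qed (simp add: w)
  then have sums: "((\<lambda>x. \<Sum>e\<in>E. w x * (cmod (e x))\<^sup>2) has_sum (\<Sum>e\<in>E. \<Sum>\<^sub>\<infinity>x. w x * (cmod (e x))\<^sup>2)) UNIV"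
    using E(1) by (intro has_sum_sum has_sum_infsum)
  have "real (card S) \<le> (\<Sum>e\<in>E. Re (B e e))"
    using fun_space.independent_span_bound[OF E(1) S(2) E(4)] E(3) by (simp add: orthonormal_def)
  also have "\<dots> \<le> (\<Sum>e\<in>E. \<Sum>\<^sub>\<infinity>x. w x * (cmod (e x))\<^sup>2)"
    using E(2) by (intro sum_mono w) auto
  also have "\<dots> \<le> (\<Sum>\<^sub>\<infinity>x. w x * K x)"
    using has_sum_mono[OF sums has_sum_infsum[OF summable]] diagonal w(1)
    by (simp add: sum_distrib_left[symmetric] mult_left_mono)
  finally show ?thesis .
qed

end

section \<open>Fourier series on the torus\<close>

definition period_measure :: "real measure" where
  "period_measure = uniform_measure lborel {-pi..pi}"

lemma sets_period_measure [simp, measurable_cong]: "sets period_measure = sets borel"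
  by (simp add: period_measure_def)

lemma prob_space_period_measure: "prob_space period_measure"
  unfolding period_measure_def by (rule prob_space_uniform_measure) simp_all

lemma period_measure_eq_density:
  "period_measure = density lborel (\<lambda>t. ennreal (indicat_real {-pi..pi} t / (2 * pi)))"
  unfolding period_measure_def uniform_measure_def
  by (intro density_cong) (auto simp: divide_ennreal ennreal_indicator[symmetric] split: split_indicator)

lemma integrable_period_measureI:
  fixes f :: "real \<Rightarrow> 'b::{banach, second_countable_topology}"
  assumes "integrable lborel (\<lambda>t. indicat_real {-pi..pi} t *\<^sub>R f t)" "f \<in> borel_measurable borel"
  shows "integrable period_measure f"
  using integrable_scaleR_right[OF assms(1), of "1 / (2 * pi)"] assms(2)
  by (simp add: period_measure_eq_density integrable_density)

lemma integral_period_measure: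
  fixes f :: "real \<Rightarrow> 'b::{banach, second_countable_topology}"
  assumes "f \<in> borel_measurable borel"
  shows "integral\<^sup>L period_measure f = (\<integral>t. indicat_real {-pi..pi} t *\<^sub>R f t \<partial>lborel) /\<^sub>R (2 * pi)"
  using assms by (simp add: period_measure_eq_density integral_density flip: integral_scaleR_right)
    (simp add: field_simps)

lemma AE_period_measure: "AE t in period_measure. 0 < \<bar>t\<bar> \<and> \<bar>t\<bar> \<le> pi"
  unfolding period_measure_def
proof (rule AE_uniform_measureI)
  show "AE t in lborel. t \<in> {-pi..pi} \<longrightarrow> 0 < \<bar>t\<bar> \<and> \<bar>t\<bar> \<le> pi"
    using AE_lborel_singleton[of 0] by eventually_elim auto
qed simp

lemma integrable_period_measure_cis: "integrable period_measure (\<lambda>t. cis (of_int k * t))"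
proof (rule integrable_period_measureI)
  show "integrable lborel (\<lambda>t. indicat_real {-pi..pi} t *\<^sub>R cis (of_int k * t))"
    by (rule borel_integrable_compact) (auto intro!: continuous_intros)
  show "(\<lambda>t. cis (of_int k * t)) \<in> borel_measurable borel"
    by (intro borel_measurable_continuous_onI continuous_intros)
qed

lemma integral_period_measure_cis: "(\<integral>t. cis (of_int k * t) \<partial>period_measure) = of_bool (k = 0)"
proof -
  have meas: "(\<lambda>t. cis (of_int k * t)) \<in> borel_measurable borel"
    by (intro borel_measurable_continuous_onI continuous_intros)
  show ?thesis
  proof (cases "k = 0")
    case True
    interpret prob_space period_measure
      by (rule prob_space_period_measure)
    show ?thesis
      using True by (simp add: prob_space)
  next
    case False
    have "(\<integral>t. indicat_real {-pi..pi} t *\<^sub>R cis (of_int k * t) \<partial>lborel)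
      = cis (of_int k * pi) / (\<i> * of_int k) - cis (of_int k * (- pi)) / (\<i> * of_int k)"
    proof (rule integral_FTC_Icc)
      show "((\<lambda>t. cis (of_int k * t) / (\<i> * of_int k)) has_vector_derivative cis (of_int k * x))
          (at x within {-pi..pi})" for x
        using False
        by (auto intro!: derivative_eq_intros
            simp: has_vector_derivative_def scaleR_conv_of_real fun_eq_iff complex_eq_iff)
    qed (auto intro!: continuous_intros)
    also have "cis (of_int k * pi) = cis (of_int k * (- pi) + 2 * pi * of_int k)"
      by (simp add: algebra_simps)
    also have "\<dots> = cis (of_int k * (- pi))"
      by (simp only: cis_mult[symmetric] cis_multiple_2pi[OF Ints_of_int]) simp
    finally show ?thesis
      using False by (simp add: integral_period_measure[OF meas])
  qed
qed

lemma integrable_period_measure_powr: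
  assumes "-1 < a"
  shows "integrable period_measure (\<lambda>t. \<bar>t\<bar> powr a)"
proof (rule integrable_period_measureI)
  let ?g = "\<lambda>t. indicat_real {0..pi} t *\<^sub>R (t powr a)"
  have "(\<lambda>t. t powr a) absolutely_integrable_on {0..pi}"
    using integrable_on_powr_from_0[OF assms] by (intro nonnegative_absolutely_integrable_1) auto
  then have g: "integrable lborel ?g"
    unfolding set_integrable_def by (subst (asm) integrable_completion) measurable
  have "integrable lborel (\<lambda>t. ?g (- t))"
    using lborel_integrable_real_affine[OF g, of "-1" 0] by simp
  from Bochner_Integration.integrable_add[OF g this]
  show "integrable lborel (\<lambda>t. indicat_real {-pi..pi} t *\<^sub>R \<bar>t\<bar> powr a)"
    by (rule Bochner_Integration.integrable_bound) (auto simp: indicator_def)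
qed measurable

text \<open>Normalized Haar measure of the torus, carried by the period cube centred at \<open>p\<close>.\<close>

definition torus_measure :: "real^'n \<Rightarrow> (real^'n) measure" where
  "torus_measure p = distr (\<Pi>\<^sub>M i\<in>UNIV. period_measure) borel (\<lambda>\<omega>. p + (\<chi> i. \<omega> i))"

lemma sets_torus_measure [simp, measurable_cong]: "sets (torus_measure p) = sets borel"
  by (simp add: torus_measure_def)

lemma measurable_vec_lambda_PiM:
  "(\<lambda>\<omega>. p + (\<chi> i. \<omega> i)) \<in> borel_measurable (\<Pi>\<^sub>M i\<in>(UNIV::'n::finite set). period_measure)"
proof -
  have "(\<lambda>\<omega>. p + (\<Sum>i\<in>UNIV. \<omega> i *\<^sub>R axis i 1)) \<in> borel_measurable (\<Pi>\<^sub>M i\<in>(UNIV::'n set). period_measure)"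
    by measurable
  moreover have "(\<chi> i. \<omega> i) = (\<Sum>i\<in>UNIV. \<omega> i *\<^sub>R axis i 1)" for \<omega> :: "'n \<Rightarrow> real"
    by (simp add: vec_eq_iff axis_def if_distrib cong: if_cong)
  ultimately show ?thesis
    by simp
qed

lemma prob_space_torus_measure: "prob_space (torus_measure p)"
  unfolding torus_measure_def
  by (intro prob_space.prob_space_distr prob_space_PiM prob_space_period_measure measurable_vec_lambda_PiM)

lemma
  fixes f :: "'n::finite \<Rightarrow> real \<Rightarrow> 'b::{real_normed_field,banach,second_countable_topology}"
  assumes f: "\<And>i. integrable period_measure (f i)"
  shows integrable_torus_prod: "integrable (torus_measure p) (\<lambda>\<theta>. \<Prod>i\<in>UNIV. f i (\<theta> $ i - p $ i))"
    and integral_torus_prod: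
      "(\<integral>\<theta>. (\<Prod>i\<in>UNIV. f i (\<theta> $ i - p $ i)) \<partial>torus_measure p) = (\<Prod>i\<in>UNIV. integral\<^sup>L period_measure (f i))"
proof -
  interpret product_sigma_finite "\<lambda>_::'n. period_measure"
    by (intro product_sigma_finite.intro finite_measure.axioms(1) prob_space.axioms(1) prob_space_period_measure)
  have [measurable]: "f i \<in> borel_measurable borel" for i
    using borel_measurable_integrable[OF f[of i]] by simp
  have meas: "(\<lambda>\<theta>::real^'n. \<Prod>i\<in>UNIV. f i (\<theta> $ i - p $ i)) \<in> borel_measurable borel"
    by measurable
  show "integrable (torus_measure p) (\<lambda>\<theta>. \<Prod>i\<in>UNIV. f i (\<theta> $ i - p $ i))"
    using product_integrable_prod[of UNIV f] f
    by (simp add: torus_measure_def integrable_distr_eq[OF measurable_vec_lambda_PiM meas])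
  show "(\<integral>\<theta>. (\<Prod>i\<in>UNIV. f i (\<theta> $ i - p $ i)) \<partial>torus_measure p) = (\<Prod>i\<in>UNIV. integral\<^sup>L period_measure (f i))"
    using product_integral_prod[of UNIV f] f
    by (simp add: torus_measure_def integral_distr[OF measurable_vec_lambda_PiM meas])
qed

definition pi_cube :: "(real^'n) set" where
  "pi_cube = {q. \<forall>i. \<bar>q $ i\<bar> \<le> pi}"

lemma compact_pi_cube: "compact (pi_cube :: (real^'n) set)"
proof -
  have "(pi_cube :: (real^'n) set) = cbox (\<chi> i. - pi) (\<chi> i. pi)"
    by (auto simp: pi_cube_def mem_box_cart abs_le_iff minus_le_iff)
  then show ?thesis
    by (metis compact_cbox)
qed

lemma AE_torus_measure:
  fixes p :: "real^'n"
  shows "AE \<theta> in torus_measure p. \<theta> - p \<in> pi_cube \<and> (\<forall>i. (\<theta> - p) $ i \<noteq> 0)"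
proof -
  have "AE \<omega> in (\<Pi>\<^sub>M i\<in>UNIV. period_measure). 0 < \<bar>\<omega> i\<bar> \<and> \<bar>\<omega> i\<bar> \<le> pi" for i :: 'n
    by (intro AE_PiM_component prob_space_period_measure AE_period_measure) simp
  then have "AE \<omega> in (\<Pi>\<^sub>M i\<in>(UNIV::'n set). period_measure). \<forall>i. 0 < \<bar>\<omega> i\<bar> \<and> \<bar>\<omega> i\<bar> \<le> pi"
    by (rule eventually_all_finite)
  then show ?thesis
    unfolding torus_measure_def
    by (subst AE_distr_iff[OF measurable_vec_lambda_PiM]) (auto simp: pi_cube_def)
qed

lemma integrable_torus_continuous:
  fixes f :: "real^'n \<Rightarrow> 'b::{banach, second_countable_topology}"
  assumes "continuous_on UNIV f"
  shows "integrable (torus_measure p) f"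
proof -
  interpret prob_space "torus_measure p"
    by (rule prob_space_torus_measure)
  have "compact ((\<lambda>q. f (p + q)) ` pi_cube)"
    by (intro compact_continuous_image compact_pi_cube continuous_on_compose2[OF assms] continuous_intros) auto
  then obtain M where M: "\<And>q. q \<in> pi_cube \<Longrightarrow> norm (f (p + q)) \<le> M"
    by (metis bounded_iff compact_imp_bounded imageI)
  show ?thesis
  proof (rule integrable_const_bound)
    show "AE \<theta> in torus_measure p. norm (f \<theta>) \<le> M"
      using AE_torus_measure
    proof eventually_elim
      case (elim \<theta>)
      then show ?case
        using M[of "\<theta> - p"] by simp
    qed
  qed (use borel_measurable_continuous_onI[OF assms] in simp)
qed

lemma cis_sum: "cis (\<Sum>i\<in>I. f i) = (\<Prod>i\<in>I. cis (f i))"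
  by (induction I rule: infinite_finite_induct) (simp_all add: cis_mult[symmetric])

lemma integral_torus_character:
  fixes z :: "int^'n"
  shows "(\<integral>\<theta>. cis (lat_to_real z \<bullet> \<theta>) \<partial>torus_measure p) = of_bool (z = 0)"
proof -
  define phase where "phase = lat_to_real z \<bullet> p"
  have "lat_to_real z \<bullet> \<theta> = phase + (\<Sum>i\<in>UNIV. of_int (z $ i) * (\<theta> $ i - p $ i))" for \<theta>
    by (simp add: phase_def lat_to_real_def inner_vec_def right_diff_distrib sum_subtractf)
  then have "cis (lat_to_real z \<bullet> \<theta>) = cis phase * (\<Prod>i\<in>UNIV. cis (of_int (z $ i) * (\<theta> $ i - p $ i)))" for \<theta>
    by (simp add: cis_mult[symmetric] cis_sum)
  then have "(\<integral>\<theta>. cis (lat_to_real z \<bullet> \<theta>) \<partial>torus_measure p) = cis phase * (\<Prod>i\<in>UNIV. of_bool (z $ i = 0))"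
    by (simp add: integral_torus_prod[OF integrable_period_measure_cis] integral_period_measure_cis)
  also have "\<dots> = of_bool (z = 0)"
    by (auto simp: phase_def vec_eq_iff lat_to_real_def inner_vec_def)
  finally show ?thesis .
qed

lemma (in finite_measure) tendsto_integral_uniform_limit:
  fixes f :: "'i \<Rightarrow> 'a \<Rightarrow> 'b::{banach, second_countable_topology}"
  assumes lim: "uniform_limit (space M) f g F" and f: "\<And>n. integrable M (f n)" and g: "integrable M g"
  shows "((\<lambda>n. integral\<^sup>L M (f n)) \<longlongrightarrow> integral\<^sup>L M g) F"
proof (rule tendstoI)
  fix \<epsilon> :: real assume "\<epsilon> > 0"
  define \<mu> where "\<mu> = measure M (space M)"
  have \<mu>: "0 \<le> \<mu>"
    by (simp add: \<mu>_def)
  then have "0 < \<epsilon> / (\<mu> + 1)"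
    using \<open>\<epsilon> > 0\<close> by simp
  from uniform_limitD[OF lim this]
  show "\<forall>\<^sub>F n in F. dist (integral\<^sup>L M (f n)) (integral\<^sup>L M g) < \<epsilon>"
  proof eventually_elim
    case (elim n)
    have "dist (integral\<^sup>L M (f n)) (integral\<^sup>L M g) = norm (\<integral>x. f n x - g x \<partial>M)"
      by (simp add: dist_norm Bochner_Integration.integral_diff f g)
    also have "\<dots> \<le> (\<integral>x. norm (f n x - g x) \<partial>M)"
      by (rule integral_norm_bound)
    also have "\<dots> \<le> (\<integral>x. \<epsilon> / (\<mu> + 1) \<partial>M)"
      using elim by (intro integral_mono integrable_norm Bochner_Integration.integrable_diff f g)
        (auto simp: dist_norm intro: less_imp_le)
    also have "\<dots> < \<epsilon>"
      using \<open>\<epsilon> > 0\<close> \<mu> by (simp add: \<mu>_def[symmetric] field_simps)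
    finally show ?case .
  qed
qed

lemma Cauchy_Schwarz_integral:
  fixes f g :: "'a \<Rightarrow> real"
  assumes [measurable]: "f \<in> borel_measurable M" "g \<in> borel_measurable M"
    and f: "integrable M (\<lambda>x. (f x)\<^sup>2)" and g: "integrable M (\<lambda>x. (g x)\<^sup>2)"
  shows "(\<integral>x. \<bar>f x * g x\<bar> \<partial>M)\<^sup>2 \<le> (\<integral>x. (f x)\<^sup>2 \<partial>M) * (\<integral>x. (g x)\<^sup>2 \<partial>M)"
proof -
  have "integrable M (\<lambda>x. \<bar>f x * g x\<bar>)"
  proof (rule Bochner_Integration.integrable_bound[OF Bochner_Integration.integrable_add[OF f g]])
    have "\<bar>f x * g x\<bar> \<le> (f x)\<^sup>2 + (g x)\<^sup>2" for x
      using sum_squares_bound[of "\<bar>f x\<bar>" "\<bar>g x\<bar>"] mult_nonneg_nonneg[of "\<bar>f x\<bar>" "\<bar>g x\<bar>"]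
      unfolding abs_mult power2_abs by linarith
    then show "AE x in M. norm \<bar>f x * g x\<bar> \<le> norm ((f x)\<^sup>2 + (g x)\<^sup>2)"
      by simp
  qed measurable
  then have "ennreal ((\<integral>x. \<bar>f x * g x\<bar> \<partial>M)\<^sup>2) = (\<integral>\<^sup>+x. ennreal \<bar>f x\<bar> * ennreal \<bar>g x\<bar> \<partial>M)\<^sup>2"
    by (simp add: nn_integral_eq_integral ennreal_power abs_mult ennreal_mult[symmetric])
  also have "\<dots> \<le> (\<integral>\<^sup>+x. (ennreal \<bar>f x\<bar>)\<^sup>2 \<partial>M) * (\<integral>\<^sup>+x. (ennreal \<bar>g x\<bar>)\<^sup>2 \<partial>M)"
    by (rule Cauchy_Schwarz_nn_integral) measurable
  also have "\<dots> = ennreal ((\<integral>x. (f x)\<^sup>2 \<partial>M) * (\<integral>x. (g x)\<^sup>2 \<partial>M))"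
    using f g by (simp add: ennreal_power nn_integral_eq_integral ennreal_mult)
  finally show ?thesis
    by (simp add: ennreal_le_iff)
qed

lemma weighted_Cauchy_Schwarz_integral:
  fixes f g D :: "'a \<Rightarrow> real"
  assumes [measurable]: "f \<in> borel_measurable M" "g \<in> borel_measurable M" "D \<in> borel_measurable M"
    and pos: "AE x in M. 0 < D x"
    and f: "integrable M (\<lambda>x. D x * (f x)\<^sup>2)" and g: "integrable M (\<lambda>x. (g x)\<^sup>2 / D x)"
  shows "(\<integral>x. \<bar>f x * g x\<bar> \<partial>M)\<^sup>2 \<le> (\<integral>x. D x * (f x)\<^sup>2 \<partial>M) * (\<integral>x. (g x)\<^sup>2 / D x \<partial>M)"
proof -
  let ?f = "\<lambda>x. sqrt (D x) * f x" and ?g = "\<lambda>x. g x / sqrt (D x)"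
  have AE_f: "AE x in M. (?f x)\<^sup>2 = D x * (f x)\<^sup>2" and AE_g: "AE x in M. (?g x)\<^sup>2 = (g x)\<^sup>2 / D x"
    and AE_fg: "AE x in M. \<bar>?f x * ?g x\<bar> = \<bar>f x * g x\<bar>"
    using pos by (eventually_elim, simp add: power_mult_distrib power_divide)+
  have "integrable M (\<lambda>x. (?f x)\<^sup>2)" "integrable M (\<lambda>x. (?g x)\<^sup>2)"
    using integrable_cong_AE[OF _ _ AE_f] integrable_cong_AE[OF _ _ AE_g] f g by simp_all
  then have "(\<integral>x. \<bar>?f x * ?g x\<bar> \<partial>M)\<^sup>2 \<le> (\<integral>x. (?f x)\<^sup>2 \<partial>M) * (\<integral>x. (?g x)\<^sup>2 \<partial>M)"
    by (intro Cauchy_Schwarz_integral) measurable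
  then show ?thesis
    using integral_cong_AE[OF _ _ AE_f] integral_cong_AE[OF _ _ AE_g] integral_cong_AE[OF _ _ AE_fg]
    by simp
qed

lemma lat_to_real_add: "lat_to_real (x + y) = lat_to_real x + lat_to_real y"
  and lat_to_real_diff: "lat_to_real (x - y) = lat_to_real x - lat_to_real y"
  and lat_to_real_uminus: "lat_to_real (- x) = - lat_to_real x"
  and lat_to_real_0 [simp]: "lat_to_real 0 = 0"
  by (simp_all add: lat_to_real_def vec_eq_iff)

definition trig_poly :: "(int^'n) set \<Rightarrow> (int^'n \<Rightarrow> complex) \<Rightarrow> real^'n \<Rightarrow> complex" where
  "trig_poly A f \<theta> = (\<Sum>z\<in>A. f z * cis (- (lat_to_real z \<bullet> \<theta>)))"

lemma continuous_on_trig_poly [continuous_intros]: "continuous_on S (trig_poly A f)"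
  unfolding trig_poly_def by (intro continuous_intros)

lemma integral_trig_poly_character:
  fixes y :: "int^'n"
  assumes "finite A"
  shows "(\<integral>\<theta>. trig_poly A f \<theta> * cis (lat_to_real y \<bullet> \<theta>) \<partial>torus_measure p) = (if y \<in> A then f y else 0)"
proof -
  have "(\<integral>\<theta>. trig_poly A f \<theta> * cis (lat_to_real y \<bullet> \<theta>) \<partial>torus_measure p)
    = (\<integral>\<theta>. (\<Sum>z\<in>A. f z * cis (lat_to_real (y - z) \<bullet> \<theta>)) \<partial>torus_measure p)"
    by (simp add: trig_poly_def sum_distrib_right mult.assoc cis_mult lat_to_real_diff inner_diff_left)
  also have "\<dots> = (\<Sum>z\<in>A. (\<integral>\<theta>. f z * cis (lat_to_real (y - z) \<bullet> \<theta>) \<partial>torus_measure p))"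
    by (intro Bochner_Integration.integral_sum integrable_torus_continuous continuous_intros)
  also have "\<dots> = (\<Sum>z\<in>A. if z = y then f y else 0)"
    by (intro sum.cong) (auto simp: integral_torus_character)
  finally show ?thesis
    using assms by simp
qed

text \<open>Since \<open>f 0 = 0\<close>, the character at \<open>x\<close> may be replaced by its deviation from its value at \<open>p\<close>.\<close>

lemma cmod_le_integral_trig_poly:
  fixes x :: "int^'n"
  assumes "finite A" "x \<in> A" "f 0 = 0"
  shows "cmod (f x) \<le> (\<integral>\<theta>. cmod (trig_poly A f \<theta>) * cmod (cis (lat_to_real x \<bullet> (\<theta> - p)) - 1) \<partial>torus_measure p)"
proof -
  let ?M = "torus_measure p" and ?F = "trig_poly A f" and ?e = "\<lambda>\<theta>. cis (lat_to_real x \<bullet> \<theta>)"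
  have "(\<integral>\<theta>. ?F \<theta> * (?e \<theta> - ?e p) \<partial>?M)
    = (\<integral>\<theta>. ?F \<theta> * ?e \<theta> - ?F \<theta> * cis (lat_to_real 0 \<bullet> \<theta>) * ?e p \<partial>?M)"
    by (simp add: algebra_simps)
  also have "\<dots> = (\<integral>\<theta>. ?F \<theta> * ?e \<theta> \<partial>?M) - (\<integral>\<theta>. ?F \<theta> * cis (lat_to_real 0 \<bullet> \<theta>) * ?e p \<partial>?M)"
    by (intro Bochner_Integration.integral_diff integrable_torus_continuous continuous_intros)
  also have "\<dots> = f x"
    unfolding integral_mult_left_zero integral_trig_poly_character[OF assms(1)] using assms by simp
  finally have "cmod (f x) = cmod (\<integral>\<theta>. ?F \<theta> * (?e \<theta> - ?e p) \<partial>?M)"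
    by simp
  also have "\<dots> \<le> (\<integral>\<theta>. cmod (?F \<theta> * (?e \<theta> - ?e p)) \<partial>?M)"
    by (rule integral_norm_bound)
  also have "(\<lambda>\<theta>. cmod (?F \<theta> * (?e \<theta> - ?e p))) = (\<lambda>\<theta>. cmod (?F \<theta>) * cmod (?e (\<theta> - p) - 1))"
  proof
    fix \<theta>
    have "?e \<theta> - ?e p = ?e p * (?e (\<theta> - p) - 1)"
      by (simp add: inner_diff_right cis_mult algebra_simps)
    then show "cmod (?F \<theta> * (?e \<theta> - ?e p)) = cmod (?F \<theta>) * cmod (?e (\<theta> - p) - 1)"
      by (simp add: norm_mult)
  qed
  finally show ?thesis .
qed

text \<open>A product weight dominating \<open>|q| powr (a - d)\<close>, so that integrability reduces to dimension one.\<close>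

definition cube_weight :: "real \<Rightarrow> real^'n \<Rightarrow> real" where
  "cube_weight a q = (\<Prod>i\<in>UNIV. \<bar>q $ i\<bar> powr (a / CARD('n) - 1))"

lemma cube_weight_nonneg: "0 \<le> cube_weight a q"
  by (simp add: cube_weight_def prod_nonneg)

lemma integrable_cube_weight:
  fixes p :: "real^'n"
  assumes "0 < a"
  shows "integrable (torus_measure p) (\<lambda>\<theta>. cube_weight a (\<theta> - p))"
  using integrable_torus_prod[of "\<lambda>(i::'n) t. \<bar>t\<bar> powr (a / CARD('n) - 1)" p] assms
  by (simp add: cube_weight_def integrable_period_measure_powr)

lemma norm_powr_le_cube_weight:
  fixes q :: "real^'n"
  assumes "\<And>i. q $ i \<noteq> 0" "a \<le> real CARD('n)"
  shows "norm q powr (a - real CARD('n)) \<le> cube_weight a q"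
proof -
  have q: "0 < norm q"
    using assms(1) by (metis zero_index zero_less_norm_iff)
  then have "norm q powr (a - real CARD('n)) = (\<Prod>i\<in>(UNIV::'n set). norm q powr (a / CARD('n) - 1))"
    by (simp add: powr_power algebra_simps)
  also have "\<dots> \<le> cube_weight a q"
    unfolding cube_weight_def
  proof (intro prod_mono conjI)
    show "norm q powr (a / CARD('n) - 1) \<le> \<bar>q $ i\<bar> powr (a / CARD('n) - 1)" for i
      using assms q by (intro powr_mono2') (auto simp: component_le_norm_cart field_simps)
  qed auto
  finally show ?thesis .
qed

lemma cmod_cis_minus_one_squared_le:
  assumes "0 \<le> s" "s \<le> 2"
  shows "(cmod (cis t - 1))\<^sup>2 \<le> 4 * \<bar>t\<bar> powr s"
proof (cases "\<bar>t\<bar> \<le> 1")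
  case True
  show ?thesis
  proof (cases "t = 0")
    case False
    have "cmod (cis t - 1) \<le> \<bar>t\<bar>"
      using iexp_approx1[of t 0] by (simp add: cis_conv_exp)
    then have "(cmod (cis t - 1))\<^sup>2 \<le> \<bar>t\<bar>\<^sup>2"
      by (intro power_mono) auto
    also have "\<dots> = \<bar>t\<bar> powr 2"
      using False by simp
    also have "\<dots> \<le> \<bar>t\<bar> powr s"
      using True False assms by (intro powr_mono') auto
    finally show ?thesis
      using powr_ge_zero[of "\<bar>t\<bar>" s] by linarith
  qed auto
next
  case False
  have "cmod (cis t - 1) \<le> 2"
    using norm_triangle_ineq4[of "cis t" 1] by simp
  then have "(cmod (cis t - 1))\<^sup>2 \<le> 2\<^sup>2"
    by (intro power_mono) auto
  also have "\<dots> \<le> 4 * \<bar>t\<bar> powr s"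
    using False assms by (simp add: ge_one_powr_ge_zero)
  finally show ?thesis .
qed

lemma character_deviation_le_cube_weight:
  fixes q :: "real^'n" and x :: "int^'n"
  assumes s: "0 \<le> s" "s \<le> 2" and "0 < c" "c * (norm q)\<^sup>2 \<le> D" and q: "\<And>i. q $ i \<noteq> 0"
  shows "(cmod (cis (lat_to_real x \<bullet> q) - 1))\<^sup>2 / D
    \<le> 4 / c * lat_norm x powr s * cube_weight (s - 2 + CARD('n)) q"
proof -
  have "0 < norm q"
    using q by (metis zero_index zero_less_norm_iff)
  then have "0 < c * (norm q)\<^sup>2"
    using \<open>0 < c\<close> by simp
  have "(cmod (cis (lat_to_real x \<bullet> q) - 1))\<^sup>2 \<le> 4 * \<bar>lat_to_real x \<bullet> q\<bar> powr s"
    using s by (rule cmod_cis_minus_one_squared_le)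
  also have "\<dots> \<le> 4 * (lat_norm x * norm q) powr s"
    using s by (intro mult_left_mono powr_mono2) (auto simp: lat_norm_def Cauchy_Schwarz_ineq2)
  finally have "(cmod (cis (lat_to_real x \<bullet> q) - 1))\<^sup>2 / D \<le> 4 * (lat_norm x * norm q) powr s / (c * (norm q)\<^sup>2)"
    using assms(4) \<open>0 < c * (norm q)\<^sup>2\<close> by (intro frac_le) auto
  also have "\<dots> = 4 / c * lat_norm x powr s * norm q powr (s - 2 + CARD('n) - real CARD('n))"
    using \<open>0 < norm q\<close> \<open>0 < c\<close> by (simp add: powr_mult powr_diff lat_norm_def)
  also have "\<dots> \<le> 4 / c * lat_norm x powr s * cube_weight (s - 2 + CARD('n)) q"
    using s \<open>0 < c\<close> powr_ge_zero[of "lat_norm x" s]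
    by (intro mult_left_mono norm_powr_le_cube_weight q) auto
  finally show ?thesis .
qed

section \<open>Hermitian convolution kernels\<close>

definition symbol :: "(int^'n \<Rightarrow> complex) \<Rightarrow> real^'n \<Rightarrow> complex" where
  "symbol k \<theta> = (\<Sum>\<^sub>\<infinity>x. k x * cis (lat_to_real x \<bullet> \<theta>))"

definition convolution_form ::
    "(int^'n) set \<Rightarrow> (int^'n \<Rightarrow> complex) \<Rightarrow> (int^'n \<Rightarrow> complex) \<Rightarrow> (int^'n \<Rightarrow> complex) \<Rightarrow> complex" where
  "convolution_form A k f g = (\<Sum>\<^sub>\<infinity>(x, z)\<in>A \<times> A. k (z - x) * f z * cnj (g x))"

locale hermitian_kernel =
  fixes k :: "int^'n \<Rightarrow> complex"
  assumes abs_summable: "(\<lambda>x. norm (k x)) summable_on UNIV"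
    and cnj_kernel: "cnj (k (- x)) = k x"
begin

lemma continuous_on_symbol [continuous_intros]: "continuous_on S (symbol k)"
proof (rule uniform_limit_theorem)
  show "uniform_limit S (\<lambda>X \<theta>. \<Sum>x\<in>X. k x * cis (lat_to_real x \<bullet> \<theta>)) (symbol k) (finite_subsets_at_top UNIV)"
    unfolding symbol_def
    by (rule Weierstrass_m_test_general[where M = "\<lambda>x. norm (k x)"]) (auto simp: norm_mult abs_summable)
qed (auto intro!: always_eventually continuous_intros)

lemma symbol_eq_disp: "symbol k \<theta> = of_real (disp k \<theta>)"
proof -
  have "cnj (symbol k \<theta>) = (\<Sum>\<^sub>\<infinity>x. cnj (k x) * cis (- (lat_to_real x \<bullet> \<theta>)))"
    by (simp add: symbol_def infsum_cnj[symmetric] cis_cnj)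
  also have "\<dots> = (\<Sum>\<^sub>\<infinity>x. cnj (k (- x)) * cis (lat_to_real x \<bullet> \<theta>))"
  proof (rule infsum_reindex_bij_witness[of UNIV uminus uminus])
    show "cnj (k (- (- x))) * cis (lat_to_real (- x) \<bullet> \<theta>) = cnj (k x) * cis (- (lat_to_real x \<bullet> \<theta>))" for x
      by (simp add: lat_to_real_uminus)
  qed auto
  also have "\<dots> = symbol k \<theta>"
    by (simp add: cnj_kernel symbol_def)
  finally have "Im (symbol k \<theta>) = 0"
    by (metis cnj.simps(2) equal_neg_zero)
  then show ?thesis
    by (simp add: complex_eq_iff disp_def symbol_def)
qed

lemma continuous_on_disp [continuous_intros]: "continuous_on S (disp k)"
  using continuous_on_Re[OF continuous_on_symbol] by (simp add: symbol_eq_disp)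

lemma integral_symbol_character:
  "(\<integral>\<theta>. symbol k \<theta> * cis (lat_to_real z \<bullet> \<theta>) \<partial>torus_measure p) = k (- z)"
proof -
  interpret prob_space "torus_measure p"
    by (rule prob_space_torus_measure)
  let ?S = "\<lambda>X \<theta>. \<Sum>x\<in>X. k x * cis (lat_to_real (x + z) \<bullet> \<theta>)"
  let ?F = "finite_subsets_at_top (UNIV :: (int^'n) set)"
  have "uniform_limit UNIV ?S (\<lambda>\<theta>. \<Sum>\<^sub>\<infinity>x. k x * cis (lat_to_real (x + z) \<bullet> \<theta>)) ?F"
    by (rule Weierstrass_m_test_general[where M = "\<lambda>x. norm (k x)"]) (auto simp: norm_mult abs_summable)
  also have "(\<lambda>\<theta>. \<Sum>\<^sub>\<infinity>x. k x * cis (lat_to_real (x + z) \<bullet> \<theta>)) = (\<lambda>\<theta>. symbol k \<theta> * cis (lat_to_real z \<bullet> \<theta>))"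
    by (simp add: symbol_def lat_to_real_add inner_add_left cis_mult[symmetric] mult.assoc[symmetric] infsum_cmult_left')
  finally have "((\<lambda>X. \<integral>\<theta>. ?S X \<theta> \<partial>torus_measure p) \<longlongrightarrow> (\<integral>\<theta>. symbol k \<theta> * cis (lat_to_real z \<bullet> \<theta>) \<partial>torus_measure p)) ?F"
    by (intro tendsto_integral_uniform_limit integrable_torus_continuous continuous_intros)
      (erule uniform_limit_on_subset, simp)
  moreover have "(\<integral>\<theta>. ?S X \<theta> \<partial>torus_measure p) = (\<Sum>x\<in>X. if x = - z then k (- z) else 0)" for X
  proof -
    have "(\<integral>\<theta>. ?S X \<theta> \<partial>torus_measure p) = (\<Sum>x\<in>X. (\<integral>\<theta>. k x * cis (lat_to_real (x + z) \<bullet> \<theta>) \<partial>torus_measure p))"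
      by (intro Bochner_Integration.integral_sum integrable_torus_continuous continuous_intros)
    then show ?thesis
      by (auto simp: integral_torus_character add_eq_0_iff2 intro!: sum.cong)
  qed
  moreover have "((\<lambda>X. \<Sum>x\<in>X. if x = - z then k (- z) else 0) \<longlongrightarrow> k (- z)) ?F"
  proof (rule tendsto_eventually)
    show "\<forall>\<^sub>F X in ?F. (\<Sum>x\<in>X. if x = - z then k (- z) else 0) = k (- z)"
      unfolding eventually_finite_subsets_at_top by (intro exI[of _ "{- z}"]) auto
  qed
  ultimately show ?thesis
    using tendsto_unique[OF finite_subsets_at_top_neq_bot] by force
qed

lemma integral_disp_trig_poly:
  assumes "finite A"
  shows "(\<integral>\<theta>. disp k \<theta> * (cmod (trig_poly A f \<theta>))\<^sup>2 \<partial>torus_measure p) = Re (convolution_form A k f f)"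
proof -
  let ?G = "\<lambda>y z \<theta>. f z * cnj (f y) * (symbol k \<theta> * cis (lat_to_real (y - z) \<bullet> \<theta>))"
  have expand: "of_real (disp k \<theta> * (cmod (trig_poly A f \<theta>))\<^sup>2) = (\<Sum>(y, z)\<in>A \<times> A. ?G y z \<theta>)" for \<theta>
  proof -
    have "of_real (disp k \<theta> * (cmod (trig_poly A f \<theta>))\<^sup>2)
      = symbol k \<theta> * (cnj (trig_poly A f \<theta>) * trig_poly A f \<theta>)"
      using complex_norm_square[of "trig_poly A f \<theta>"] by (simp add: symbol_eq_disp mult.commute)
    also have "cnj (trig_poly A f \<theta>) * trig_poly A f \<theta>
      = (\<Sum>y\<in>A. \<Sum>z\<in>A. f z * cnj (f y) * cis (lat_to_real (y - z) \<bullet> \<theta>))"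
      unfolding trig_poly_def cnj_sum sum_product
      by (intro sum.cong refl) (simp add: cis_cnj lat_to_real_diff inner_diff_left cis_mult algebra_simps)
    finally show ?thesis
      by (simp add: sum_distrib_left sum.cartesian_product mult.left_commute split_def)
  qed
  have "of_real (\<integral>\<theta>. disp k \<theta> * (cmod (trig_poly A f \<theta>))\<^sup>2 \<partial>torus_measure p)
    = (\<integral>\<theta>. (\<Sum>(y, z)\<in>A \<times> A. ?G y z \<theta>) \<partial>torus_measure p)"
    unfolding expand[symmetric] by (rule integral_complex_of_real[symmetric])
  also have "\<dots> = (\<Sum>(y, z)\<in>A \<times> A. \<integral>\<theta>. ?G y z \<theta> \<partial>torus_measure p)"
    unfolding split_def
    by (intro Bochner_Integration.integral_sum integrable_torus_continuous continuous_intros)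
  also have "\<dots> = convolution_form A k f f"
    using assms by (simp add: convolution_form_def integral_symbol_character split_def mult_ac)
  finally show ?thesis
    by (metis Re_complex_of_real)
qed

lemma AE_character_deviation:
  fixes x :: "int^'n"
  assumes s: "0 \<le> s" "s \<le> 2"
    and c: "0 < c" "\<And>q. q \<in> pi_cube \<Longrightarrow> c * (norm q)\<^sup>2 \<le> disp k (p + q)"
  shows "AE \<theta> in torus_measure p. 0 < disp k \<theta> \<and>
    (cmod (cis (lat_to_real x \<bullet> (\<theta> - p)) - 1))\<^sup>2 / disp k \<theta>
      \<le> 4 / c * lat_norm x powr s * cube_weight (s - 2 + CARD('n)) (\<theta> - p)"
  using AE_torus_measure[of p]
proof eventually_elim
  case (elim \<theta>)
  then have bound: "c * (norm (\<theta> - p))\<^sup>2 \<le> disp k \<theta>"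
    using c(2)[of "\<theta> - p"] by simp
  have "0 < c * (norm (\<theta> - p))\<^sup>2"
    using c(1) elim by (metis mult_pos_pos zero_index zero_less_norm_iff zero_less_power)
  with bound have "0 < disp k \<theta>"
    by linarith
  moreover have "(cmod (cis (lat_to_real x \<bullet> (\<theta> - p)) - 1))\<^sup>2 / disp k \<theta>
      \<le> 4 / c * lat_norm x powr s * cube_weight (s - 2 + CARD('n)) (\<theta> - p)"
    using elim by (intro character_deviation_le_cube_weight s c(1) bound) auto
  ultimately show ?case ..
qed

lemma point_bound_finite_support:
  assumes s: "0 \<le> s" "s \<le> 2" "2 - real CARD('n) < s"
    and c: "0 < c" "\<And>q. q \<in> pi_cube \<Longrightarrow> c * (norm q)\<^sup>2 \<le> disp k (p + q)"
    and J: "(\<integral>\<theta>. cube_weight (s - 2 + CARD('n)) (\<theta> - p) \<partial>torus_measure p) \<le> J"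
    and A: "finite A" "x \<in> A" "f 0 = 0"
  shows "(cmod (f x))\<^sup>2 \<le> 4 / c * J * lat_norm x powr s * Re (convolution_form A k f f)"
proof -
  let ?M = "torus_measure p" and ?F = "\<lambda>\<theta>. cmod (trig_poly A f \<theta>)"
  let ?b = "\<lambda>\<theta>. cmod (cis (lat_to_real x \<bullet> (\<theta> - p)) - 1)"
  let ?W = "\<lambda>\<theta>. 4 / c * lat_norm x powr s * cube_weight (s - 2 + CARD('n)) (\<theta> - p)"
  have AE_b: "AE \<theta> in ?M. 0 < disp k \<theta> \<and> (?b \<theta>)\<^sup>2 / disp k \<theta> \<le> ?W \<theta>"
    using s c by (intro AE_character_deviation)
  have AE_pos: "AE \<theta> in ?M. 0 < disp k \<theta>" and AE_le: "AE \<theta> in ?M. (?b \<theta>)\<^sup>2 / disp k \<theta> \<le> ?W \<theta>"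
    using AE_b by (eventually_elim, simp)+
  have int_W: "integrable ?M ?W"
    using s by (intro integrable_mult_right integrable_cube_weight) simp
  have meas: "?b \<in> borel_measurable ?M" "disp k \<in> borel_measurable ?M" "?F \<in> borel_measurable ?M"
    by (intro borel_measurable_integrable integrable_torus_continuous continuous_intros)+
  have int_b: "integrable ?M (\<lambda>\<theta>. (?b \<theta>)\<^sup>2 / disp k \<theta>)"
  proof (rule Bochner_Integration.integrable_bound[OF int_W])
    show "AE \<theta> in ?M. norm ((?b \<theta>)\<^sup>2 / disp k \<theta>) \<le> norm (?W \<theta>)"
      using AE_b by eventually_elim (smt (verit) real_norm_def divide_nonneg_pos zero_le_power2)
  qed (use meas in measurable)
  have "(\<integral>\<theta>. (?b \<theta>)\<^sup>2 / disp k \<theta> \<partial>?M) \<le> (\<integral>\<theta>. ?W \<theta> \<partial>?M)"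
    by (intro integral_mono_AE int_b int_W AE_le)
  also have "\<dots> \<le> 4 / c * lat_norm x powr s * J"
    unfolding integral_mult_right_zero using c(1) by (intro mult_left_mono J) simp
  finally have b_le: "(\<integral>\<theta>. (?b \<theta>)\<^sup>2 / disp k \<theta> \<partial>?M) \<le> 4 / c * lat_norm x powr s * J" .
  have energy: "0 \<le> (\<integral>\<theta>. disp k \<theta> * (?F \<theta>)\<^sup>2 \<partial>?M)"
  proof (rule integral_nonneg_AE)
    show "AE \<theta> in ?M. 0 \<le> disp k \<theta> * (?F \<theta>)\<^sup>2"
      using AE_pos by eventually_elim simp
  qed
  have "(cmod (f x))\<^sup>2 \<le> (\<integral>\<theta>. \<bar>?F \<theta> * ?b \<theta>\<bar> \<partial>?M)\<^sup>2"
    using cmod_le_integral_trig_poly[of A x f p, OF A] by (intro power_mono) auto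
  also have "\<dots> \<le> (\<integral>\<theta>. disp k \<theta> * (?F \<theta>)\<^sup>2 \<partial>?M) * (\<integral>\<theta>. (?b \<theta>)\<^sup>2 / disp k \<theta> \<partial>?M)"
    by (intro weighted_Cauchy_Schwarz_integral meas AE_pos int_b integrable_torus_continuous continuous_intros)
  also have "\<dots> \<le> (\<integral>\<theta>. disp k \<theta> * (?F \<theta>)\<^sup>2 \<partial>?M) * (4 / c * lat_norm x powr s * J)"
    by (intro mult_left_mono b_le energy)
  also have "\<dots> = 4 / c * J * lat_norm x powr s * Re (convolution_form A k f f)"
    by (simp add: integral_disp_trig_poly[OF A(1)])
  finally show ?thesis .
qed

end

section \<open>Forms on square-summable functions\<close>

lemma l2_add:
  assumes "l2 f" "l2 g"
  shows "l2 (f + g)"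
proof -
  have "(\<lambda>x. 2 * (cmod (f x))\<^sup>2 + 2 * (cmod (g x))\<^sup>2) summable_on UNIV"
    using assms unfolding l2_def by (intro summable_on_add summable_on_cmult_right)
  then show ?thesis
    unfolding l2_def
  proof (rule summable_on_comparison_test)
    fix x
    have "(cmod ((f + g) x))\<^sup>2 \<le> (cmod (f x) + cmod (g x))\<^sup>2"
      by (intro power_mono) (simp_all add: norm_triangle_ineq)
    also have "\<dots> \<le> 2 * (cmod (f x))\<^sup>2 + 2 * (cmod (g x))\<^sup>2"
      using sum_squares_bound[of "cmod (f x)" "cmod (g x)"] by (simp add: power2_sum)
    finally show "(cmod ((f + g) x))\<^sup>2 \<le> 2 * (cmod (f x))\<^sup>2 + 2 * (cmod (g x))\<^sup>2" .
  qed simp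
qed

lemma subspace_l2: "fun_space.subspace {f. l2 f}"
proof (rule fun_space.subspaceI)
  show "0 \<in> {f. l2 f}"
    by (simp add: l2_def)
  show "f + g \<in> {f. l2 f}" if "f \<in> {f. l2 f}" "g \<in> {f. l2 f}" for f g :: "int^'a \<Rightarrow> complex"
    using that by (simp add: l2_add)
  show "scale_fun a f \<in> {f. l2 f}" if "f \<in> {f. l2 f}" for a and f :: "int^'a \<Rightarrow> complex"
    using that by (simp add: l2_def norm_mult power_mult_distrib summable_on_cmult_right)
qed

definition multiplication_form ::
    "(int^'n \<Rightarrow> real) \<Rightarrow> (int^'n \<Rightarrow> complex) \<Rightarrow> (int^'n \<Rightarrow> complex) \<Rightarrow> complex" where
  "multiplication_form w f g = (\<Sum>\<^sub>\<infinity>x. of_real (w x) * f x * cnj (g x))"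

abbreviation l2_inner :: "(int^'n \<Rightarrow> complex) \<Rightarrow> (int^'n \<Rightarrow> complex) \<Rightarrow> complex" where
  "l2_inner \<equiv> multiplication_form (\<lambda>_. 1)"

lemma multiplication_form_has_sum:
  assumes "l2 f" "l2 g" and w: "\<And>x. \<bar>w x\<bar> \<le> M"
  shows "((\<lambda>x. of_real (w x) * f x * cnj (g x)) has_sum multiplication_form w f g) UNIV"
proof -
  have "(\<lambda>x. norm (f x * f x)) summable_on UNIV" "(\<lambda>x. norm (cnj (g x) * cnj (g x))) summable_on UNIV"
    using assms(1,2) by (simp_all add: l2_def norm_mult power2_eq_square)
  then have "(\<lambda>x. norm (f x * cnj (g x))) summable_on UNIV"
    by (rule abs_summable_product)
  then have "(\<lambda>x. M * norm (f x * cnj (g x))) summable_on UNIV"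
    by (rule summable_on_cmult_right)
  then have "(\<lambda>x. norm (of_real (w x) * f x * cnj (g x))) summable_on UNIV"
    by (rule summable_on_comparison_test) (simp_all add: norm_mult w mult.assoc mult_right_mono)
  then show ?thesis
    unfolding multiplication_form_def by (rule has_sum_infsum[OF abs_summable_summable])
qed

lemma hermitian_multiplication_form:
  fixes w :: "int^'n \<Rightarrow> real"
  assumes w: "\<And>x. \<bar>w x\<bar> \<le> M"
  shows "hermitian_form_on scale_fun {f. l2 f} (multiplication_form w)"
proof
  show "fun_space.subspace {f :: int^'n \<Rightarrow> complex. l2 f}"
    by (rule subspace_l2)
  fix f g h :: "int^'n \<Rightarrow> complex" and a
  assume "f \<in> {f. l2 f}" "h \<in> {f. l2 f}"
  then have fh: "((\<lambda>x. of_real (w x) * f x * cnj (h x)) has_sum multiplication_form w f h) UNIV"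
    using w by (intro multiplication_form_has_sum) auto
  show "multiplication_form w (scale_fun a f) h = a * multiplication_form w f h"
    using infsumI[OF has_sum_cmult_right[OF fh, of a]] by (simp add: multiplication_form_def mult_ac)
  show "multiplication_form w h f = cnj (multiplication_form w f h)"
    by (simp add: multiplication_form_def infsum_cnj[symmetric] mult_ac)
  assume "g \<in> {f. l2 f}"
  then have gh: "((\<lambda>x. of_real (w x) * g x * cnj (h x)) has_sum multiplication_form w g h) UNIV"
    using \<open>h \<in> {f. l2 f}\<close> w by (intro multiplication_form_has_sum) auto
  show "multiplication_form w (f + g) h = multiplication_form w f h + multiplication_form w g h"
    using infsumI[OF has_sum_add[OF fh gh]] by (simp add: multiplication_form_def algebra_simps)
qed

lemma Re_multiplication_form_self:
  assumes "l2 f" and w: "\<And>x. \<bar>w x\<bar> \<le> M"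
  shows "((\<lambda>x. w x * (cmod (f x))\<^sup>2) has_sum Re (multiplication_form w f f)) UNIV"
  using has_sum_Re[OF multiplication_form_has_sum[OF assms(1,1) w]]
  by (simp add: mult.assoc complex_mult_cnj cmod_power2)

lemma summable_on_product_nonneg:
  fixes a :: "'a \<Rightarrow> real" and b :: "'b \<Rightarrow> real"
  assumes "a summable_on A" "b summable_on B" "\<And>x. x \<in> A \<Longrightarrow> 0 \<le> a x" "\<And>y. y \<in> B \<Longrightarrow> 0 \<le> b y"
  shows "(\<lambda>(x, y). a x * b y) summable_on (A \<times> B)"
proof (rule summable_on_SigmaI)
  show "((\<lambda>y. case (x, y) of (x, y) \<Rightarrow> a x * b y) has_sum a x * infsum b B) B" for x
    using assms(2) by (auto intro!: has_sum_cmult_right)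
  show "(\<lambda>x. a x * infsum b B) summable_on A"
    by (intro summable_on_cmult_left assms)
qed (use assms in auto)

lemma has_sum_Times_tendsto:
  assumes "(f has_sum S) (UNIV :: ('a \<times> 'a) set)"
  shows "((\<lambda>A. sum f (A \<times> A)) \<longlongrightarrow> S) (finite_subsets_at_top UNIV)"
proof -
  have "\<forall>\<^sub>F A :: 'a set in finite_subsets_at_top UNIV. finite (A \<times> A) \<and> X \<subseteq> A \<times> A \<and> A \<times> A \<subseteq> UNIV"
    if "finite X" for X :: "('a \<times> 'a) set"
    unfolding eventually_finite_subsets_at_top
  proof (intro exI[of _ "fst ` X \<union> snd ` X"] conjI allI impI)
    show "X \<subseteq> A \<times> A" if "finite A \<and> fst ` X \<union> snd ` X \<subseteq> A \<and> A \<subseteq> UNIV" for A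
      using that by force
  qed (use that in auto)
  then have "filterlim (\<lambda>A :: 'a set. A \<times> A) (finite_subsets_at_top UNIV) (finite_subsets_at_top UNIV)"
    unfolding filterlim_finite_subsets_at_top by blast
  with assms show ?thesis
    unfolding has_sum_def by (rule filterlim_compose)
qed

context hermitian_kernel
begin

lemma norm_kernel_diff_commute: "norm (k (x - z)) = norm (k (z - x))"
  using cnj_kernel[of "z - x"] by (metis complex_mod_cnj minus_diff_eq)

lemma kernel_times_square_summable:
  assumes "l2 f"
  shows "(\<lambda>(x, z). norm (k (z - x)) * (cmod (f z))\<^sup>2) summable_on UNIV"
    and "(\<lambda>(x, z). norm (k (z - x)) * (cmod (f x))\<^sup>2) summable_on UNIV"
proof -
  have "(\<lambda>(x, z). norm (k (z - x)) * (cmod (f z))\<^sup>2) summable_on UNIV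
    \<longleftrightarrow> (\<lambda>(y, z). norm (k y) * (cmod (f z))\<^sup>2) summable_on UNIV"
    by (rule summable_on_reindex_bij_witness[of _ "\<lambda>(y, z). (z - y, z)" "\<lambda>(x, z). (z - x, z)"]) auto
  then show "(\<lambda>(x, z). norm (k (z - x)) * (cmod (f z))\<^sup>2) summable_on UNIV"
    using summable_on_product_nonneg[OF abs_summable, of "\<lambda>z. (cmod (f z))\<^sup>2" UNIV] assms
    by (simp add: l2_def)
  then have "(\<lambda>(x, z). norm (k (x - z)) * (cmod (f x))\<^sup>2) summable_on UNIV"
    using summable_on_swap[of "\<lambda>(x, z). norm (k (z - x)) * (cmod (f z))\<^sup>2" UNIV UNIV] by simp
  then show "(\<lambda>(x, z). norm (k (z - x)) * (cmod (f x))\<^sup>2) summable_on UNIV"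
    by (simp only: norm_kernel_diff_commute)
qed

lemma convolution_form_has_sum:
  assumes "l2 f" "l2 g"
  shows "((\<lambda>(x, z). k (z - x) * f z * cnj (g x)) has_sum convolution_form UNIV k f g) UNIV"
proof -
  have "(\<lambda>y. norm (case y of (x, z) \<Rightarrow> k (z - x) * f z * cnj (g x))) summable_on UNIV"
  proof (rule summable_on_comparison_test[OF summable_on_add[OF
          kernel_times_square_summable(1)[OF assms(1)] kernel_times_square_summable(2)[OF assms(2)]]],
      clarsimp simp: norm_mult mult.assoc)
    fix x z
    have "cmod (f z) * cmod (g x) \<le> (cmod (f z))\<^sup>2 + (cmod (g x))\<^sup>2"
      using sum_squares_bound[of "cmod (f z)" "cmod (g x)"]
        mult_nonneg_nonneg[OF norm_ge_zero[of "f z"] norm_ge_zero[of "g x"]] by linarith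
    then show "norm (k (z - x)) * (cmod (f z) * cmod (g x))
      \<le> norm (k (z - x)) * (cmod (f z))\<^sup>2 + norm (k (z - x)) * (cmod (g x))\<^sup>2"
      unfolding distrib_left[symmetric] by (rule mult_left_mono) simp
  qed simp
  then show ?thesis
    unfolding convolution_form_def UNIV_Times_UNIV by (rule has_sum_infsum[OF abs_summable_summable])
qed

lemma hermitian_convolution_form:
  "hermitian_form_on scale_fun {f. l2 f} (convolution_form UNIV k)"
proof
  show "fun_space.subspace {f :: int^'n \<Rightarrow> complex. l2 f}"
    by (rule subspace_l2)
  fix f g h :: "int^'n \<Rightarrow> complex" and a
  assume "f \<in> {f. l2 f}" "h \<in> {f. l2 f}"
  then have fh: "((\<lambda>(x, z). k (z - x) * f z * cnj (h x)) has_sum convolution_form UNIV k f h) UNIV"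
    by (simp add: convolution_form_has_sum)
  show "convolution_form UNIV k (scale_fun a f) h = a * convolution_form UNIV k f h"
    using infsumI[OF has_sum_cmult_right[OF fh, of a]] by (simp add: convolution_form_def split_def mult_ac)
  have "cnj (k (z - x)) = k (x - z)" for x z
    using cnj_kernel[of "x - z"] by simp
  then show "convolution_form UNIV k h f = cnj (convolution_form UNIV k f h)"
    unfolding convolution_form_def infsum_cnj[symmetric]
    by (intro infsum_reindex_bij_witness[of _ prod.swap prod.swap]) auto
  assume "g \<in> {f. l2 f}"
  then have gh: "((\<lambda>(x, z). k (z - x) * g z * cnj (h x)) has_sum convolution_form UNIV k g h) UNIV"
    using \<open>h \<in> {f. l2 f}\<close> by (simp add: convolution_form_has_sum)
  show "convolution_form UNIV k (f + g) h = convolution_form UNIV k f h + convolution_form UNIV k g h"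
    using infsumI[OF has_sum_add[OF fh gh]] by (simp add: convolution_form_def split_def algebra_simps)
qed

lemma convolution_form_tendsto:
  assumes "l2 f" "l2 g"
  shows "((\<lambda>A. convolution_form A k f g) \<longlongrightarrow> convolution_form UNIV k f g) (finite_subsets_at_top UNIV)"
proof (rule Lim_transform_eventually)
  show "((\<lambda>A. \<Sum>(x, z)\<in>A \<times> A. k (z - x) * f z * cnj (g x)) \<longlongrightarrow> convolution_form UNIV k f g)
      (finite_subsets_at_top UNIV)"
    by (intro has_sum_Times_tendsto convolution_form_has_sum assms)
  show "\<forall>\<^sub>F A in finite_subsets_at_top UNIV. (\<Sum>(x, z)\<in>A \<times> A. k (z - x) * f z * cnj (g x)) = convolution_form A k f g"
    by (rule eventually_finite_subsets_at_top_weakI) (simp add: convolution_form_def)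
qed

lemma point_bound:
  assumes s: "0 \<le> s" "s \<le> 2" "2 - real CARD('n) < s"
    and c: "0 < c" "\<And>q. q \<in> pi_cube \<Longrightarrow> c * (norm q)\<^sup>2 \<le> disp k (p + q)"
  obtains C where "0 < C" "\<And>f x. l2 f \<Longrightarrow> f 0 = 0 \<Longrightarrow>
    (cmod (f x))\<^sup>2 \<le> C * lat_norm x powr s * Re (convolution_form UNIV k f f)"
proof
  define J where "J = (\<integral>\<theta>. cube_weight (s - 2 + CARD('n)) (\<theta> - p) \<partial>torus_measure p) + 1"
  have "0 < J"
    by (simp add: J_def cube_weight_nonneg add_nonneg_pos)
  with c(1) show "0 < 4 / c * J"
    by simp
  fix f :: "int^'n \<Rightarrow> complex" and x assume f: "l2 f" "f 0 = 0"
  show "(cmod (f x))\<^sup>2 \<le> 4 / c * J * lat_norm x powr s * Re (convolution_form UNIV k f f)"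
  proof (rule tendsto_lowerbound)
    show "((\<lambda>A. 4 / c * J * lat_norm x powr s * Re (convolution_form A k f f)) \<longlongrightarrow>
        4 / c * J * lat_norm x powr s * Re (convolution_form UNIV k f f)) (finite_subsets_at_top UNIV)"
      by (intro tendsto_intros convolution_form_tendsto f)
    have "(cmod (f x))\<^sup>2 \<le> 4 / c * J * lat_norm x powr s * Re (convolution_form A k f f)"
      if "finite A" "x \<in> A" for A
      using that f(2) by (intro point_bound_finite_support[OF s c]) (simp_all add: J_def)
    then show "\<forall>\<^sub>F A in finite_subsets_at_top UNIV.
        (cmod (f x))\<^sup>2 \<le> 4 / c * J * lat_norm x powr s * Re (convolution_form A k f f)"
      unfolding eventually_finite_subsets_at_top by (intro exI[of _ "{x}"]) auto
  qed simp
qed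

lemma convolution_form_as_iterated_sum:
  assumes "l2 f" "l2 g"
  shows "((\<lambda>x. (\<Sum>\<^sub>\<infinity>y. k y * f (x + y)) * cnj (g x)) has_sum convolution_form UNIV k f g) UNIV"
proof (rule has_sum_SigmaD)
  show sum: "((\<lambda>(x, z). k (z - x) * f z * cnj (g x)) has_sum convolution_form UNIV k f g) (UNIV \<times> UNIV)"
    using convolution_form_has_sum[OF assms] by simp
  fix x
  have "(\<Sum>\<^sub>\<infinity>z. k (z - x) * f z * cnj (g x)) = (\<Sum>\<^sub>\<infinity>z. k (z - x) * f z) * cnj (g x)"
    by (rule infsum_cmult_left')
  also have "(\<Sum>\<^sub>\<infinity>z. k (z - x) * f z) = (\<Sum>\<^sub>\<infinity>y. k y * f (x + y))"
    by (rule infsum_reindex_bij_witness[of _ "\<lambda>y. x + y" "\<lambda>z. z - x"]) auto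
  moreover have "(\<lambda>z. k (z - x) * f z * cnj (g x)) summable_on UNIV"
    using summable_on_SigmaD1[OF has_sum_imp_summable[OF sum]] by simp
  ultimately show "((\<lambda>z. case (x, z) of (x, z) \<Rightarrow> k (z - x) * f z * cnj (g x)) has_sum
      (\<Sum>\<^sub>\<infinity>y. k y * f (x + y)) * cnj (g x)) UNIV"
    by (simp add: has_sum_iff)
qed

lemma is_eigvec_weak:
  assumes "is_eigvec k v \<mu> E f" "l2 g" and v: "\<And>x. \<bar>\<mu> * v x\<bar> \<le> M"
  shows "convolution_form UNIV k f g + multiplication_form (\<lambda>x. \<mu> * v x) f g = of_real E * l2_inner f g"
proof -
  have f: "l2 f" "\<And>x. hop k v \<mu> f x = of_real E * f x"
    using assms(1) by (auto simp: is_eigvec_def)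
  have "((\<lambda>x. hop k v \<mu> f x * cnj (g x)) has_sum
      convolution_form UNIV k f g + multiplication_form (\<lambda>x. \<mu> * v x) f g) UNIV"
    using has_sum_add[OF convolution_form_as_iterated_sum multiplication_form_has_sum, OF f(1) assms(2) f(1) assms(2) v]
    by (simp add: hop_def distrib_right)
  moreover have "((\<lambda>x. hop k v \<mu> f x * cnj (g x)) has_sum of_real E * l2_inner f g) UNIV"
    using has_sum_cmult_right[OF multiplication_form_has_sum[OF f(1) assms(2), of "\<lambda>_. 1" 1], of "of_real E"]
    by (simp add: f(2) mult.assoc)
  ultimately show ?thesis
    by (rule has_sum_unique)
qed

end

section \<open>The top of the band\<close>

lemma disp_periodic:
  fixes p :: "real^'n"
  shows "disp k (p + (2 * pi) *\<^sub>R lat_to_real m) = disp k p"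
proof -
  have "cis (lat_to_real x \<bullet> (p + (2 * pi) *\<^sub>R lat_to_real m)) = cis (lat_to_real x \<bullet> p)" for x :: "int^'n"
  proof -
    have "lat_to_real x \<bullet> lat_to_real m \<in> \<int>"
      by (auto simp: lat_to_real_def inner_vec_def intro!: Ints_sum)
    then show ?thesis
      by (simp add: inner_add_right cis_mult[symmetric] cis_multiple_2pi)
  qed
  then show ?thesis
    by (simp add: disp_def)
qed

lemma torus_representative:
  fixes p :: "real^'n"
  obtains m where "p + (2 * pi) *\<^sub>R lat_to_real m \<in> torus"
proof
  define m :: "int^'n" where "m = (\<chi> i. \<lfloor>(pi - p $ i) / (2 * pi)\<rfloor>)"
  have "- pi < p $ i + (2 * pi) * of_int (m $ i) \<and> p $ i + (2 * pi) * of_int (m $ i) \<le> pi" for i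
  proof -
    have "of_int (m $ i) \<le> (pi - p $ i) / (2 * pi)" "(pi - p $ i) / (2 * pi) < of_int (m $ i) + 1"
      unfolding m_def by auto
    then show ?thesis
      using pi_gt_zero by (simp add: field_simps)
  qed
  then show "p + (2 * pi) *\<^sub>R lat_to_real m \<in> torus"
    by (simp add: torus_def lat_to_real_def)
qed

lemma period_in_pi_cube_eq_0:
  assumes "(2 * pi) *\<^sub>R lat_to_real m \<in> pi_cube"
  shows "m = 0"
proof -
  have "m $ i = 0" for i
  proof -
    have "2 * \<bar>of_int (m $ i) :: real\<bar> * pi \<le> 1 * pi"
      using assms by (auto simp: pi_cube_def lat_to_real_def abs_mult mult_ac)
    then have "2 * \<bar>of_int (m $ i) :: real\<bar> \<le> 1"
      using pi_gt_zero by (simp only: mult_le_cancel_right_pos)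
    then show ?thesis
      by linarith
  qed
  then show ?thesis
    by (simp add: vec_eq_iff)
qed

locale nondegenerate_band_top = hermitian_kernel k for k :: "int^'n \<Rightarrow> complex" +
  fixes p :: "real^'n"
  assumes unique_max: "q \<in> torus \<Longrightarrow> q \<noteq> p \<Longrightarrow> disp k q < disp k p"
    and nondegenerate: "C2_nondeg_at (disp k) p"
begin

lemma disp_le_top: "disp k q \<le> disp k p"
  by (metis disp_periodic torus_representative unique_max order.order_iff_strict)

lemma disp_less_top:
  assumes "q \<in> pi_cube" "q \<noteq> 0"
  shows "disp k (p + q) < disp k p"
proof -
  obtain m where m: "p + q + (2 * pi) *\<^sub>R lat_to_real m \<in> torus"
    using torus_representative by blast
  have "p + q + (2 * pi) *\<^sub>R lat_to_real m \<noteq> p"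
  proof
    assume "p + q + (2 * pi) *\<^sub>R lat_to_real m = p"
    then have q: "q = (2 * pi) *\<^sub>R lat_to_real (- m)"
      by (simp add: add.assoc eq_neg_iff_add_eq_0 lat_to_real_uminus)
    with assms(1) have "- m = 0"
      by (metis period_in_pi_cube_eq_0)
    with q assms(2) show False
      by simp
  qed
  with unique_max[OF m] show ?thesis
    by (simp add: disp_periodic)
qed

lemma quadratic_bound:
  obtains c where "0 < c" "\<And>q. q \<in> pi_cube \<Longrightarrow> c * (norm q)\<^sup>2 \<le> disp k p - disp k (p + q)"
proof -
  obtain c r where c: "0 < c" "0 < r" "\<And>q. q \<in> ball p r \<Longrightarrow> c * (norm (q - p))\<^sup>2 \<le> disp k p - disp k q"
    using nondegenerate_max_quadratic_bound[OF nondegenerate disp_le_top] by blast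
  show thesis
  proof (rule quadratic_lower_bound_on_compact[OF compact_pi_cube _ _ c(1,2)])
    show "continuous_on pi_cube (\<lambda>q. disp k p - disp k (p + q))"
      by (intro continuous_intros continuous_on_compose2[OF continuous_on_disp[of UNIV]]) auto
    show "0 < disp k p - disp k (p + q)" if "q \<in> pi_cube" "q \<noteq> 0" for q
      using disp_less_top[OF that] by simp
    show "c * (norm q)\<^sup>2 \<le> disp k p - disp k (p + q)" if "q \<in> ball 0 r" for q
      using c(3)[of "p + q"] that by (simp add: dist_norm)
  qed (rule that)
qed

end

definition shifted_kernel :: "real \<Rightarrow> (int^'n \<Rightarrow> complex) \<Rightarrow> int^'n \<Rightarrow> complex" where
  "shifted_kernel t k x = of_real t * of_bool (x = 0) - k x"

context hermitian_kernel
begin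

lemma hermitian_kernel_shifted: "hermitian_kernel (shifted_kernel t k)"
proof
  have "(\<lambda>x :: int^'n. \<bar>t\<bar> * of_bool (x = 0)) summable_on UNIV"
    by (rule finite_nonzero_values_imp_summable_on) simp
  then have "(\<lambda>x. \<bar>t\<bar> * of_bool (x = 0) + norm (k x)) summable_on UNIV"
    by (intro summable_on_add abs_summable)
  then show "(\<lambda>x. norm (shifted_kernel t k x)) summable_on UNIV"
  proof (rule summable_on_comparison_test)
    show "norm (shifted_kernel t k x) \<le> \<bar>t\<bar> * of_bool (x = 0) + norm (k x)" for x
      using norm_triangle_ineq4[of "of_real t" "k x"] by (cases "x = 0") (auto simp: shifted_kernel_def)
  qed simp
  show "cnj (shifted_kernel t k (- x)) = shifted_kernel t k x" for x
    by (simp add: shifted_kernel_def cnj_kernel)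
qed

lemma disp_shifted: "disp (shifted_kernel t k) \<theta> = t - disp k \<theta>"
proof -
  let ?e = "\<lambda>x. cis (lat_to_real x \<bullet> \<theta>)"
  have "((\<lambda>x. of_real t * of_bool (x = 0) * ?e x) has_sum of_real t) UNIV"
    by (rule has_sum_finite_neutralI[of "{0}"]) auto
  moreover have "(\<lambda>x. norm (k x * ?e x)) summable_on UNIV"
    using abs_summable by (simp add: norm_mult)
  then have "((\<lambda>x. - (k x * ?e x)) has_sum - symbol k \<theta>) UNIV"
    unfolding symbol_def by (intro has_sum_uminusI has_sum_infsum) (rule abs_summable_summable)
  ultimately have "symbol (shifted_kernel t k) \<theta> = of_real t - symbol k \<theta>"
    unfolding symbol_def[of "shifted_kernel t k"] using has_sum_add
    by (intro infsumI) (fastforce simp: shifted_kernel_def left_diff_distrib)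
  then show ?thesis
    by (simp add: disp_def symbol_def[symmetric])
qed

lemma convolution_form_shifted:
  assumes "l2 f" "l2 g"
  shows "convolution_form UNIV (shifted_kernel t k) f g = of_real t * l2_inner f g - convolution_form UNIV k f g"
proof -
  have "((\<lambda>x. f x * cnj (g x)) has_sum l2_inner f g) UNIV"
    using multiplication_form_has_sum[OF assms, of "\<lambda>_. 1" 1] by simp
  then have "((\<lambda>(x, z). f z * cnj (g x)) has_sum l2_inner f g) (range (\<lambda>x. (x, x)))"
    by (subst has_sum_reindex) (auto simp: inj_on_def o_def)
  also have "?this \<longleftrightarrow> ((\<lambda>(x, z). of_bool (z - x = 0) * f z * cnj (g x)) has_sum l2_inner f g) UNIV"
    by (rule has_sum_cong_neutral) auto
  finally have "((\<lambda>y. of_real t * (case y of (x, z) \<Rightarrow> of_bool (z - x = 0) * f z * cnj (g x))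
      + - (case y of (x, z) \<Rightarrow> k (z - x) * f z * cnj (g x)))
      has_sum (of_real t * l2_inner f g + - convolution_form UNIV k f g)) UNIV"
    by (intro has_sum_add has_sum_cmult_right has_sum_uminusI convolution_form_has_sum assms)
  from infsumI[OF this] show ?thesis
    by (simp add: convolution_form_def[of _ "shifted_kernel t k"] shifted_kernel_def split_def algebra_simps)
qed

lemma shifted_form_le_multiplication_form:
  fixes v :: "int^'n \<Rightarrow> real"
  assumes "finite S" and ev: "\<And>f. f \<in> S \<Longrightarrow> \<exists>E\<ge>t. is_eigvec k v \<mu> E f"
    and u: "u \<in> fun_space.span S" and bound: "\<And>x. \<bar>\<mu> * v x\<bar> \<le> M"
  shows "Re (convolution_form UNIV (shifted_kernel t k) u u) \<le> Re (multiplication_form (\<lambda>x. \<mu> * v x) u u)"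
proof -
  obtain \<epsilon> where \<epsilon>: "\<And>f. f \<in> S \<Longrightarrow> t \<le> \<epsilon> f \<and> is_eigvec k v \<mu> (\<epsilon> f) f"
    using ev by metis
  define Q where "Q f g = multiplication_form (\<lambda>x. \<mu> * v x) f g - convolution_form UNIV (shifted_kernel t k) f g" for f g
  interpret shifted: hermitian_kernel "shifted_kernel t k"
    by (rule hermitian_kernel_shifted)
  interpret Q: hermitian_form_on scale_fun "{f. l2 f}" Q
    unfolding Q_def
    by (intro hermitian_form_on_diff hermitian_multiplication_form[OF bound] shifted.hermitian_convolution_form)
  interpret inner: hermitian_form_on scale_fun "{f :: int^'n \<Rightarrow> complex. l2 f}" l2_inner
    by (rule hermitian_multiplication_form[of _ 1]) simp
  interpret hermitian_pencil scale_fun "{f. l2 f}" Q l2_inner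
  proof
    show "0 \<le> Re (l2_inner f f)" if "f \<in> {f. l2 f}" for f :: "int^'n \<Rightarrow> complex"
      using Re_multiplication_form_self[of f "\<lambda>_. 1" 1] that by (auto intro: has_sum_nonneg)
  qed
  have "0 \<le> \<epsilon> f - t \<and> eigenvector (\<epsilon> f - t) f" if "f \<in> S" for f
  proof -
    have "l2 f"
      using \<epsilon>[OF that] by (simp add: is_eigvec_def)
    moreover have "Q f g = of_real (\<epsilon> f - t) * l2_inner f g" if "l2 g" for g
      using is_eigvec_weak[of v \<mu> "\<epsilon> f" f g M] \<epsilon>[OF \<open>f \<in> S\<close>] that \<open>l2 f\<close> bound
      by (simp add: Q_def convolution_form_shifted algebra_simps)
    ultimately show ?thesis
      using \<epsilon>[OF that] by (simp add: eigenvector_def)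
  qed
  then have "0 \<le> Re (Q u u)"
    using \<open>finite S\<close> u by (intro nonneg_on_span_eigenvectors[of S "\<lambda>f. \<epsilon> f - t" u]) auto
  then show ?thesis
    by (simp add: Q_def)
qed

lemma shifted_form_le_potential:
  fixes v :: "int^'n \<Rightarrow> real"
  assumes "finite S" "\<And>f. f \<in> S \<Longrightarrow> \<exists>E\<ge>t. is_eigvec k v \<mu> E f" "u \<in> fun_space.span S" and "l2 u"
    and "0 \<le> \<mu>" and v: "\<And>x. \<bar>v x\<bar> \<le> M"
  shows "Re (convolution_form UNIV (shifted_kernel t k) u u) \<le> (\<Sum>\<^sub>\<infinity>x. \<mu> * \<bar>v x\<bar> * (cmod (u x))\<^sup>2)"
proof -
  have bound: "\<bar>\<mu> * v x\<bar> \<le> \<mu> * M" "\<bar>\<mu> * \<bar>v x\<bar>\<bar> \<le> \<mu> * M" for x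
    using v \<open>0 \<le> \<mu>\<close> by (simp_all add: abs_mult mult_left_mono)
  have "Re (convolution_form UNIV (shifted_kernel t k) u u) \<le> Re (multiplication_form (\<lambda>x. \<mu> * v x) u u)"
    using assms(1-3) bound(1) by (rule shifted_form_le_multiplication_form)
  also have "\<dots> \<le> Re (multiplication_form (\<lambda>x. \<mu> * \<bar>v x\<bar>) u u)"
    using Re_multiplication_form_self[OF \<open>l2 u\<close> bound(1)] Re_multiplication_form_self[OF \<open>l2 u\<close> bound(2)]
    by (rule has_sum_mono) (simp add: mult_left_mono mult_right_mono \<open>0 \<le> \<mu>\<close>)
  also have "\<dots> = (\<Sum>\<^sub>\<infinity>x. \<mu> * \<bar>v x\<bar> * (cmod (u x))\<^sup>2)"
    using infsumI[OF Re_multiplication_form_self[OF \<open>l2 u\<close> bound(2)]] by simp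
  finally show ?thesis .
qed

end

abbreviation weighted_summable :: "real \<Rightarrow> (int^'n \<Rightarrow> real) \<Rightarrow> bool" where
  "weighted_summable s v \<equiv> (\<lambda>x. lat_norm x powr s * \<bar>v x\<bar>) summable_on UNIV"

abbreviation weighted_norm :: "real \<Rightarrow> (int^'n \<Rightarrow> real) \<Rightarrow> real" where
  "weighted_norm s v \<equiv> (\<Sum>\<^sub>\<infinity>x. lat_norm x powr s * \<bar>v x\<bar>)"

lemma one_le_lat_norm:
  assumes "x \<noteq> 0"
  shows "1 \<le> lat_norm x"
proof -
  obtain i where "x $ i \<noteq> 0"
    using assms by (auto simp: vec_eq_iff)
  then have "1 \<le> \<bar>lat_to_real x $ i\<bar>"
    by (simp add: lat_to_real_def)
  also have "\<dots> \<le> lat_norm x"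
    unfolding lat_norm_def by (rule component_le_norm_cart)
  finally show ?thesis .
qed

lemma bounded_if_weighted_summable:
  assumes summable: "weighted_summable s v" and "0 \<le> s"
  obtains M where "\<And>x. \<bar>v x\<bar> \<le> M"
proof
  fix x
  have "\<bar>v x\<bar> \<le> lat_norm x powr s * \<bar>v x\<bar>" if "x \<noteq> 0"
    using one_le_lat_norm[OF that] \<open>0 \<le> s\<close> by (simp add: ge_one_powr_ge_zero mult_le_cancel_right1)
  also have "lat_norm x powr s * \<bar>v x\<bar> \<le> weighted_norm s v"
    using finite_sum_le_infsum[OF summable, of "{x}"] by simp
  finally show "\<bar>v x\<bar> \<le> max \<bar>v 0\<bar> (weighted_norm s v)"
    by (cases "x = 0") auto
qed

lemma (in nondegenerate_band_top) point_bound_top: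
  assumes s: "0 \<le> s" "s \<le> 2" "2 - real CARD('n) < s"
  obtains C where "0 < C" "\<And>u x. l2 u \<Longrightarrow> u 0 = 0 \<Longrightarrow>
    (cmod (u x))\<^sup>2 \<le> C * lat_norm x powr s * Re (convolution_form UNIV (shifted_kernel (disp k p) k) u u)"
proof -
  interpret shifted: hermitian_kernel "shifted_kernel (disp k p) k"
    by (rule hermitian_kernel_shifted)
  obtain c where c: "0 < c" "\<And>q. q \<in> pi_cube \<Longrightarrow> c * (norm q)\<^sup>2 \<le> disp k p - disp k (p + q)"
    using quadratic_bound by blast
  show thesis
  proof (rule shifted.point_bound[OF s c(1)])
    show "c * (norm q)\<^sup>2 \<le> disp (shifted_kernel (disp k p) k) (p + q)" if "q \<in> pi_cube" for q
      using c(2)[OF that] by (simp add: disp_shifted)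
  qed (rule that)
qed

lemma (in hermitian_kernel) card_eigenvectors_le:
  fixes v :: "int^'n \<Rightarrow> real"
  assumes "0 \<le> C" and point: "\<And>u x. l2 u \<Longrightarrow> u 0 = 0 \<Longrightarrow>
      (cmod (u x))\<^sup>2 \<le> C * lat_norm x powr s * Re (convolution_form UNIV (shifted_kernel t k) u u)"
    and v: "weighted_summable s v" and "0 \<le> s" "0 \<le> \<mu>"
    and S: "finite S" "fun_space.independent S"
    and ev: "\<And>f. f \<in> S \<Longrightarrow> \<exists>E\<ge>t. is_eigvec k v \<mu> E f"
  shows "real (card S) \<le> 1 + C * \<mu> * weighted_norm s v"
proof (cases "S = {}")
  case True
  then show ?thesis
    using \<open>0 \<le> C\<close> \<open>0 \<le> \<mu>\<close> by (simp add: infsum_nonneg add_nonneg_nonneg)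
next
  case False
  define V where "V = {u \<in> fun_space.span S. u 0 = 0}"
  define K where "K x = C * lat_norm x powr s" for x :: "int^'n"
  have K: "(\<lambda>x. \<mu> * \<bar>v x\<bar> * K x) = (\<lambda>x. C * \<mu> * (lat_norm x powr s * \<bar>v x\<bar>))"
    by (simp add: K_def mult_ac)
  obtain T where T: "finite T" "fun_space.independent T" "T \<subseteq> V" "card S \<le> Suc (card T)"
    using fun_space.independent_subset_kernel[OF S False, of "\<lambda>u. u 0"] unfolding V_def by auto
  obtain M where M: "\<And>x. \<bar>v x\<bar> \<le> M"
    using bounded_if_weighted_summable[OF v \<open>0 \<le> s\<close>] by blast
  have "S \<subseteq> {f. l2 f}"
    using ev by (auto simp: is_eigvec_def)
  then have V_l2: "V \<subseteq> {f. l2 f}"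
    unfolding V_def using fun_space.span_minimal[OF _ subspace_l2] by blast
  have "fun_space.subspace V"
    unfolding V_def by (rule fun_space.subspaceI)
      (auto intro: fun_space.span_zero fun_space.span_add fun_space.span_scale)
  then interpret hermitian_form_on_functions V "convolution_form UNIV (shifted_kernel t k)"
    using hermitian_form_on_mono[OF hermitian_kernel.hermitian_convolution_form[OF hermitian_kernel_shifted] _ V_l2]
    by (simp add: hermitian_form_on_functions_def)
  have "real (card T) \<le> (\<Sum>\<^sub>\<infinity>x. \<mu> * \<bar>v x\<bar> * K x)"
  proof (rule card_independent_le_trace[OF T(1-3)])
    show "(cmod (u x))\<^sup>2 \<le> K x * Re (convolution_form UNIV (shifted_kernel t k) u u)" if "u \<in> V" for u x
      using point[of u x] that V_l2 by (auto simp: K_def V_def)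
    show "Re (convolution_form UNIV (shifted_kernel t k) u u) \<le> (\<Sum>\<^sub>\<infinity>x. \<mu> * \<bar>v x\<bar> * (cmod (u x))\<^sup>2)"
      if "u \<in> V" for u
      using that V_l2 by (intro shifted_form_le_potential[OF S(1) ev _ _ \<open>0 \<le> \<mu>\<close> M]) (auto simp: V_def)
    show "(\<lambda>x. \<mu> * \<bar>v x\<bar> * K x) summable_on UNIV"
      unfolding K by (intro summable_on_cmult_right v)
  qed (use \<open>0 \<le> C\<close> \<open>0 \<le> \<mu>\<close> in \<open>auto simp: K_def\<close>)
  also have "\<dots> = C * \<mu> * weighted_norm s v"
    unfolding K by (rule infsum_cmult_right')
  finally show ?thesis
    using T(4) by linarith
qed

lemma eig_count_le:
  assumes "\<And>S. finite S \<Longrightarrow> lin_indep S \<Longrightarrow> (\<And>f. f \<in> S \<Longrightarrow> \<exists>E\<in>I. is_eigvec k v \<mu> E f) \<Longrightarrow> real (card S) \<le> r"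
  shows "ereal_of_enat (eig_count k v \<mu> I) \<le> ereal r"
proof -
  have "eig_count k v \<mu> I \<le> enat (nat \<lfloor>r\<rfloor>)"
    unfolding eig_count_def by (intro SUP_least) (auto intro!: le_nat_floor assms)
  then have "ereal_of_enat (eig_count k v \<mu> I) \<le> ereal_of_enat (enat (nat \<lfloor>r\<rfloor>))"
    by (simp only: ereal_of_enat_le_iff)
  also have "\<dots> \<le> ereal r"
    using assms[of "{}"] by (simp add: lin_indep_def)
  finally show ?thesis .
qed

theorem (in nondegenerate_band_top) Nplus_le:
  assumes s: "0 \<le> s" "s \<le> 2" "2 - real CARD('n) < s"
  obtains C where "0 < C" "\<And>v \<mu>. weighted_summable s v \<Longrightarrow> 0 < \<mu> \<Longrightarrow>
    ereal_of_enat (Nplus k v \<mu> (disp k p)) \<le> ereal (1 + C * \<mu> * weighted_norm s v)"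
proof -
  obtain C where C: "0 < C" "\<And>u x. l2 u \<Longrightarrow> u 0 = 0 \<Longrightarrow>
      (cmod (u x))\<^sup>2 \<le> C * lat_norm x powr s * Re (convolution_form UNIV (shifted_kernel (disp k p) k) u u)"
    using point_bound_top[OF s] by blast
  show thesis
  proof (rule that[OF C(1)])
    fix v :: "int^'n \<Rightarrow> real" and \<mu> :: real
    assume v: "weighted_summable s v" and \<mu>: "0 < \<mu>"
    show "ereal_of_enat (Nplus k v \<mu> (disp k p)) \<le> ereal (1 + C * \<mu> * weighted_norm s v)"
      unfolding Nplus_def
    proof (rule eig_count_le)
      fix S assume "finite S" "lin_indep S" and ev: "\<And>f. f \<in> S \<Longrightarrow> \<exists>E\<in>{disp k p<..}. is_eigvec k v \<mu> E f"
      moreover have "\<exists>E\<ge>disp k p. is_eigvec k v \<mu> E f" if "f \<in> S" for f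
        using ev[OF that] by (auto intro: less_imp_le)
      ultimately show "real (card S) \<le> 1 + C * \<mu> * weighted_norm s v"
        using C v s(1) \<mu> by (intro card_eigenvectors_le[of C s "disp k p"]) (auto simp: lin_indep_iff_independent)
    qed
  qed
qed

section \<open>Reflection of the spectrum\<close>

lemma is_eigvec_uminus:
  "is_eigvec (\<lambda>x. - k x) (\<lambda>x. - v x) \<mu> (- E) f \<longleftrightarrow> is_eigvec k v \<mu> E f"
proof -
  have "hop (\<lambda>x. - k x) (\<lambda>x. - v x) \<mu> f x = - hop k v \<mu> f x" for x
    by (simp add: hop_def infsum_uminus)
  then show ?thesis
    by (simp add: is_eigvec_def)
qed

lemma Nminus_eq_Nplus: "Nminus k v \<mu> t = Nplus (\<lambda>x. - k x) (\<lambda>x. - v x) \<mu> (- t)"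
proof -
  have "(\<exists>E\<in>{..<t}. is_eigvec k v \<mu> E f) \<longleftrightarrow> (\<exists>E\<in>{-t<..}. is_eigvec (\<lambda>x. - k x) (\<lambda>x. - v x) \<mu> E f)" for f
    using is_eigvec_uminus[of k v \<mu> _ f]
    by (metis add.inverse_inverse greaterThan_iff lessThan_iff neg_less_iff_less)
  then show ?thesis
    by (simp add: Nminus_def Nplus_def eig_count_def)
qed

lemma disp_uminus: "disp (\<lambda>x. - k x) \<theta> = - disp k \<theta>"
  by (simp add: disp_def infsum_uminus)

lemma (in hermitian_kernel) nondegenerate_band_top_uminus:
  assumes "\<And>q. q \<in> torus \<Longrightarrow> q \<noteq> p \<Longrightarrow> disp k p < disp k q" and "C2_nondeg_at (disp k) p"
  shows "nondegenerate_band_top (\<lambda>x. - k x) p"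
proof
  show "C2_nondeg_at (disp (\<lambda>x. - k x)) p"
    using C2_nondeg_at_uminus[OF assms(2)] by (simp add: disp_uminus[abs_def])
qed (use abs_summable cnj_kernel assms(1) in \<open>simp_all add: disp_uminus\<close>)

theorem (in hermitian_kernel) Nminus_le:
  assumes min: "\<And>q. q \<in> torus \<Longrightarrow> q \<noteq> p \<Longrightarrow> disp k p < disp k q" and "C2_nondeg_at (disp k) p"
    and s: "0 \<le> s" "s \<le> 2" "2 - real CARD('n) < s"
  obtains C where "0 < C" "\<And>v \<mu>. weighted_summable s v \<Longrightarrow> 0 < \<mu> \<Longrightarrow>
    ereal_of_enat (Nminus k v \<mu> (disp k p)) \<le> ereal (1 + C * \<mu> * weighted_norm s v)"
proof -
  interpret reflected: nondegenerate_band_top "\<lambda>x. - k x" p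
    using assms(1,2) by (rule nondegenerate_band_top_uminus)
  show thesis
  proof (rule reflected.Nplus_le[OF s])
    fix C assume "0 < C" and bound: "\<And>v \<mu>. weighted_summable s v \<Longrightarrow> 0 < \<mu> \<Longrightarrow>
      ereal_of_enat (Nplus (\<lambda>x. - k x) v \<mu> (disp (\<lambda>x. - k x) p)) \<le> ereal (1 + C * \<mu> * weighted_norm s v)"
    show thesis
      using \<open>0 < C\<close>
    proof (rule that)
      show "ereal_of_enat (Nminus k v \<mu> (disp k p)) \<le> ereal (1 + C * \<mu> * weighted_norm s v)"
        if "weighted_summable s v" "0 < \<mu>" for v \<mu>
        using bound[of "\<lambda>x. - v x" \<mu>] that by (simp add: Nminus_eq_Nplus disp_uminus)
    qed
  qed
qed

lemma enat_add_less_infinity: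
  assumes "ereal_of_enat n \<le> ereal r" "ereal_of_enat m \<le> ereal r'"
  shows "n + m < \<infinity>"
  using assms by (cases n; cases m) auto

theorem theorem1p1:
  fixes eh :: "int^'n \<Rightarrow> complex" and \<gamma> :: real
  assumes dim: "CARD('n) = 1 \<or> CARD('n) = 2"
    and l1: "(\<lambda>x. norm (eh x)) summable_on UNIV"
    and sym: "\<And>x. cnj (eh (- x)) = eh x"
    and minpt: "p0 \<in> torus" "\<And>p. p \<in> torus \<Longrightarrow> p \<noteq> p0 \<Longrightarrow> disp eh p0 < disp eh p"
    and maxpt: "p1 \<in> torus" "\<And>p. p \<in> torus \<Longrightarrow> p \<noteq> p1 \<Longrightarrow> disp eh p < disp eh p1"
    and C2min: "C2_nondeg_at (disp eh) p0"
    and C2max: "C2_nondeg_at (disp eh) p1"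
    and gam: "0 < \<gamma>" "\<gamma> < 1"
  shows "\<exists>C1 C2. C1 > 0 \<and> C2 > 0 \<and>
    (\<forall>(v :: int^'n \<Rightarrow> real) \<mu>.
       (\<lambda>x. lat_norm x powr (2 - real CARD('n) + \<gamma>) * \<bar>v x\<bar>) summable_on UNIV \<longrightarrow>
       0 < (\<Sum>\<^sub>\<infinity>x. lat_norm x powr (2 - real CARD('n) + \<gamma>) * \<bar>v x\<bar>) \<longrightarrow>
       \<mu> > 0 \<longrightarrow>
       ereal_of_enat (Nplus eh v \<mu> (disp eh p1)) \<le>
          ereal (1 + C1 * \<mu> * (\<Sum>\<^sub>\<infinity>x. lat_norm x powr (2 - real CARD('n) + \<gamma>) * \<bar>v x\<bar>)) \<and>
       ereal_of_enat (Nminus eh v \<mu> (disp eh p0)) \<le>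
          ereal (1 + C2 * \<mu> * (\<Sum>\<^sub>\<infinity>x. lat_norm x powr (2 - real CARD('n) + \<gamma>) * \<bar>v x\<bar>)) \<and>
       Nplus eh v \<mu> (disp eh p1) + Nminus eh v \<mu> (disp eh p0) < \<infinity>)"
proof -
  define s where "s = 2 - real CARD('n) + \<gamma>"
  have s: "0 \<le> s" "s \<le> 2" "2 - real CARD('n) < s"
    using dim gam by (auto simp: s_def)
  interpret hermitian_kernel eh
    using l1 sym by unfold_locales
  interpret nondegenerate_band_top eh p1
    using maxpt(2) C2max by unfold_locales
  obtain C1 where C1: "0 < C1" "\<And>v \<mu>. weighted_summable s v \<Longrightarrow> 0 < \<mu> \<Longrightarrow>
      ereal_of_enat (Nplus eh v \<mu> (disp eh p1)) \<le> ereal (1 + C1 * \<mu> * weighted_norm s v)"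
    using Nplus_le[OF s] by blast
  obtain C2 where C2: "0 < C2" "\<And>v \<mu>. weighted_summable s v \<Longrightarrow> 0 < \<mu> \<Longrightarrow>
      ereal_of_enat (Nminus eh v \<mu> (disp eh p0)) \<le> ereal (1 + C2 * \<mu> * weighted_norm s v)"
    using Nminus_le[OF minpt(2) C2min s] by blast
  show ?thesis
    unfolding s_def[symmetric]
  proof (rule exI[of _ C1], rule exI[of _ C2], intro conjI allI impI)
    fix v :: "int^'n \<Rightarrow> real" and \<mu> :: real
    assume "weighted_summable s v" "0 < \<mu>"
    note bounds = C1(2)[OF this] C2(2)[OF this]
    show "ereal_of_enat (Nplus eh v \<mu> (disp eh p1)) \<le> ereal (1 + C1 * \<mu> * weighted_norm s v)"
      "ereal_of_enat (Nminus eh v \<mu> (disp eh p0)) \<le> ereal (1 + C2 * \<mu> * weighted_norm s v)"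
      "Nplus eh v \<mu> (disp eh p1) + Nminus eh v \<mu> (disp eh p0) < \<infinity>"
      using bounds enat_add_less_infinity[OF bounds] by auto
  qed (use C1 C2 in auto)
qed

end
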